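(* Consider the high-dimensional setting described in the context, with $s_0=o(\sqrt n)$. Assume that there is a constant $C_0>0$ (not depending on $n$) such that the eigenvalues $0<\lambda_1(\Sigma)\le\cdots\le\lambda_p(\Sigma)$ of $\Sigma$ satisfy $C_0\le\lambda_1(\Sigma)\le\lambda_p(\Sigma)\le C_0^{-1}$, and that $\|\Omega\|_1<\infty$ (i.e. $\|\Omega\|_1$ is bounded by a constant not depending on $n$). Then $$\max_{i,j=1,\dots,p}|\hat\omega_{ij}-\omega_{ij}| = O_P\big(\sqrt{\log p/n}\big)\quad\text{as } n\to\infty .$$
   Context: Asymptotic setting: everything is indexed by the sample size $n\to\infty$; the dimension $p=p_n$ grows with $n$, and the sparsity $s_0=s_{0,n}\ge 1$ and the matrices below may depend on $n$. $X_1,\dots,X_n$ are i.i.d. random vectors from $N(\mu,\Sigma)$ in $\mathbb R^p$, with $\Sigma$ symmetric positive definite, and $\Omega=\Sigma^{-1}=(\omega_{ij})$ is the precision matrix, with columns $w_1,\dots,w_p$. The positions of the nonzero entries of $\Omega$ are known, and each column of $\Omega$ has exactly $s_0$ nonzero entries. For $i=1,\dots,p$, let $B_i$ be the $p\times s_0$ zero-one matrix whose columns are the standard basis vectors of $\mathbb R^p$ indexed by the support of $w_i$, in increasing order. Let $e_i$ be the $i$-th standard basis vector of $\mathbb R^p$. Let $\bar X=\frac1n\sum_{k=1}^nX_k$ and let $S_n=\frac1{n-1}\sum_{k=1}^n(X_k-\bar X)(X_k-\bar X)^T$ be the sample covariance matrix ($B_i^TS_nB_i$ is almost surely invertible when $n>s_0$).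 The estimator of $w_i$ is $\hat w_i=B_i(B_i^TS_nB_i)^{-1}B_i^Te_i$, and $\hat\Omega=(\hat w_1,\dots,\hat w_p)=(\hat\omega_{ij})$. For a matrix $A=(a_{ij})$, $\|A\|_1=\max_j\sum_i|a_{ij}|$. $X_n=O_P(Y_n)$ means that $X_n/Y_n$ is bounded in probability.
   Formalization: The formal theorem adds the assumption log p = O(n), without which the claim is false (e.g. Σ = I, s_0 = 1, log p of order n²); "p grows with n" is read as p → ∞. *)

theory Defs
  imports
    "HOL-Probability.Probability"
    "HOL-Library.Landau_Symbols"
    "Jordan_Normal_Form.Gauss_Jordan_Elimination"
    "Jordan_Normal_Form.Char_Poly"
begin

text \<open>Since the dimension varies with the sample size, matrices and vectors are those of
  Jordan_Normal_Form (dimensions are values, indices start at 0), while a random vector in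
  \<open>p\<close>-space is a measurable map into the product space over the index set \<open>{..<p}\<close>.\<close>

hide_const (open) Determinants.det

text \<open>The value at singular matrices is a convention only.\<close>

definition inv_mat :: "real mat \<Rightarrow> real mat" where
  "inv_mat A = (case mat_inverse A of Some B \<Rightarrow> B | None \<Rightarrow> 0\<^sub>m (dim_row A) (dim_row A))"

lemma inv_mat_correct:
  assumes A: "A \<in> carrier_mat n n" and "det A \<noteq> 0"
  shows "inv_mat A \<in> carrier_mat n n" "A * inv_mat A = 1\<^sub>m n" "inv_mat A * A = 1\<^sub>m n"
proof -
  have "A \<in> Units (ring_mat TYPE(real) n ())"
    by (rule det_non_zero_imp_unit[OF A assms(2)])
  then obtain B where B: "mat_inverse A = Some B"
    using mat_inverse(1)[OF A, of "()"] by (cases "mat_inverse A") auto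
  show "inv_mat A \<in> carrier_mat n n" "A * inv_mat A = 1\<^sub>m n" "inv_mat A * A = 1\<^sub>m n"
    using mat_inverse(2)[OF A B] B by (simp_all add: inv_mat_def)
qed

definition sym_pos_def :: "nat \<Rightarrow> real mat \<Rightarrow> bool" where
  "sym_pos_def p A \<longleftrightarrow> A \<in> carrier_mat p p \<and> transpose_mat A = A \<and>
     (\<forall>v \<in> carrier_vec p. v \<noteq> 0\<^sub>v p \<longrightarrow> scalar_prod v (A *\<^sub>v v) > 0)"

definition norm1_mat :: "real mat \<Rightarrow> real" where
  "norm1_mat A = (MAX j\<in>{..<dim_col A}. \<Sum>i<dim_row A. \<bar>A $$ (i, j)\<bar>)"

definition normal_vec_density :: "nat \<Rightarrow> real vec \<Rightarrow> real mat \<Rightarrow> (nat \<Rightarrow> real) \<Rightarrow> real" where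
  "normal_vec_density p \<mu> \<Sigma> x =
     (let y = vec p x - \<mu> in
      exp (- scalar_prod y (inv_mat \<Sigma> *\<^sub>v y) / 2) / sqrt ((2 * pi) ^ p * det \<Sigma>))"

definition normal_vec ::
    "'a measure \<Rightarrow> nat \<Rightarrow> real vec \<Rightarrow> real mat \<Rightarrow> ('a \<Rightarrow> nat \<Rightarrow> real) \<Rightarrow> bool" where
  "normal_vec M p \<mu> \<Sigma> X \<longleftrightarrow>
     distributed M (Pi\<^sub>M {..<p} (\<lambda>_. lborel)) X (\<lambda>x. ennreal (normal_vec_density p \<mu> \<Sigma> x))"

text \<open>In the following, \<open>x k i\<close> is the \<open>i\<close>-th coordinate of the \<open>k\<close>-th observation, \<open>k < n\<close>.\<close>

definition sample_mean :: "nat \<Rightarrow> (nat \<Rightarrow> nat \<Rightarrow> real) \<Rightarrow> nat \<Rightarrow> real" where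
  "sample_mean n x i = (\<Sum>k<n. x k i) / real n"

definition sample_cov :: "nat \<Rightarrow> nat \<Rightarrow> (nat \<Rightarrow> nat \<Rightarrow> real) \<Rightarrow> real mat" where
  "sample_cov p n x = mat p p (\<lambda>(i, j).
     (\<Sum>k<n. (x k i - sample_mean n x i) * (x k j - sample_mean n x j)) / (real n - 1))"

definition col_support :: "real mat \<Rightarrow> nat \<Rightarrow> nat set" where
  "col_support A i = {j. j < dim_row A \<and> A $$ (j, i) \<noteq> 0}"

definition selection_mat :: "nat \<Rightarrow> nat set \<Rightarrow> real mat" where
  "selection_mat p T = mat_of_cols p (map (unit_vec p) (sorted_list_of_set T))"

definition col_estimator :: "nat \<Rightarrow> nat set \<Rightarrow> real mat \<Rightarrow> nat \<Rightarrow> real vec" where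
  "col_estimator p T S i =
     (let B = selection_mat p T
      in B *\<^sub>v (inv_mat (transpose_mat B * S * B) *\<^sub>v (transpose_mat B *\<^sub>v unit_vec p i)))"

text \<open>The argument \<open>T\<close> is the known zero pattern: \<open>T i\<close> is the support of the \<open>i\<close>-th column.\<close>

definition precision_estimator ::
    "nat \<Rightarrow> (nat \<Rightarrow> nat set) \<Rightarrow> nat \<Rightarrow> (nat \<Rightarrow> nat \<Rightarrow> real) \<Rightarrow> real mat" where
  "precision_estimator p T n x =
     mat_of_cols p (map (\<lambda>i. col_estimator p (T i) (sample_cov p n x) i) [0..<p])"

text \<open>Stochastic boundedness relative to a rate \<open>r\<close>, where the \<open>n\<close>-th random variable lives on the
  \<open>n\<close>-th probability space. The probability of the good event is bounded from below, so that a
  non-measurable event (which has \<open>measure\<close> 0) cannot make the condition hold vacuously.\<close>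

definition bigO_P :: "(nat \<Rightarrow> 'a measure) \<Rightarrow> (nat \<Rightarrow> 'a \<Rightarrow> real) \<Rightarrow> (nat \<Rightarrow> real) \<Rightarrow> bool" where
  "bigO_P M Y r \<longleftrightarrow>
     (\<forall>\<epsilon>>0. \<exists>K>0. \<forall>\<^sub>F n in sequentially.
        measure (M n) {\<omega> \<in> space (M n). \<bar>Y n \<omega>\<bar> \<le> K * \<bar>r n\<bar>} \<ge> 1 - \<epsilon>)"

end

theory Submission imports Defs begin

unbundle no vec_syntax and no inner_syntax

text \<open>Fix a column \<open>i\<close> with support \<open>T\<close>. On the coordinates in \<open>T\<close> the true column \<open>w\<close>
solves \<open>\<Sigma> w = e\<^sub>i\<close>, and the estimated column \<open>u\<close> solves \<open>S u = e\<^sub>i\<close>, where \<open>S\<close> is the sample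
covariance matrix. With \<open>\<Delta> = S - \<Sigma>\<close> and with \<open>q\<close> supported on \<open>T\<close> such that \<open>\<Sigma> q = e\<^sub>j\<close> on
\<open>T\<close>, the error is
\<open>u\<^sub>j - w\<^sub>j = - q \<bullet> \<Delta> w - q \<bullet> \<Delta> (u - w)\<close> (\<open>linear_system_perturbation\<close>). The two terms are
controlled in different ways.

The first term involves only the \<open>p\<^sup>2\<close> pairs of fixed vectors \<open>q\<close>, \<open>w\<close>, which have bounded
norm because the spectrum of \<open>\<Sigma>\<close> is bounded away from zero. By polarization it reduces to quadratic
forms \<open>a \<bullet> S a\<close> of fixed vectors \<open>a\<close>, which are scaled chi-square variables. Their
exponential tails and a union bound give the rate \<open>\<surd>(log p / n)\<close>.

The second term is at most a constant times \<open>\<parallel>\<Delta>\<parallel>\<^sup>2 / \<lambda>\<close>, with the operator norm of \<open>\<Delta>\<close> and the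
smallest eigenvalue \<open>\<lambda>\<close> of \<open>S\<close> taken on the vectors supported on \<open>T\<close>. A net of
exponentially many (in \<open>s\<^sub>0\<close>) lattice points gives \<open>\<parallel>\<Delta>\<parallel>\<^sup>2 = O((s\<^sub>0 + log p) / n)\<close> for all columns
at once (\<open>net_controls_quadratic_form\<close>). This is where \<open>s\<^sub>0 = o(\<surd>n)\<close> enters: it makes \<open>s\<^sub>0 / n\<close>
smaller than \<open>\<surd>(log p / n)\<close>, and \<open>log p / n\<close> is of this order because \<open>log p = O(n)\<close>. When
\<open>log p\<close> is proportional to \<open>n\<close>, the norm of \<open>\<Delta>\<close> need not be small, so \<open>\<lambda>\<close> cannot be bounded below
by comparing \<open>S\<close> with \<open>\<Sigma>\<close>. Instead, for every \<open>A\<close> there is a \<open>c > 0\<close> such that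
a chi-square variable with \<open>n - 1 \<ge> 1\<close> degrees of freedom is below \<open>c (n - 1)\<close> with probability at most \<open>exp (- A n)\<close>.
For large \<open>A\<close> this survives a union over all columns and a sufficiently fine net
(\<open>net_lower_bound_quadratic_form\<close>).

Two computations replace the usual distribution theory. The law of a linear functional
of a Gaussian vector follows from translating the density (\<open>normal_vec_exponential_tilt\<close>), and
centring at the sample mean is handled by an exact moment generating function
(\<open>centered_sum_squares_mgf\<close>), so no orthogonal transformation of the sample is needed.\<close>

section \<open>Linear functionals of a Gaussian vector\<close>

lemma nn_integral_PiM_lborel_translate:
  fixes t :: "'i \<Rightarrow> real"
  assumes I: "finite I"
    and F[measurable]: "F \<in> borel_measurable (Pi\<^sub>M I (\<lambda>_. lborel :: real measure))"
  shows "(\<integral>\<^sup>+x. F x \<partial>Pi\<^sub>M I (\<lambda>_. lborel)) =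
         (\<integral>\<^sup>+x. F (\<lambda>i\<in>I. x i + t i) \<partial>Pi\<^sub>M I (\<lambda>_. lborel))"
proof -
  let ?L = "Pi\<^sub>M I (\<lambda>_. lborel :: real measure)"
  let ?s = "\<lambda>x. \<lambda>i\<in>I. x i + t i"
  interpret product_sigma_finite "\<lambda>_. lborel :: real measure"
    by standard
  have s[measurable]: "?s \<in> measurable ?L ?L"
    by measurable
  have "distr ?L ?L ?s = ?L"
  proof (rule PiM_eqI[OF I])
    fix A :: "'i \<Rightarrow> real set"
    assume A: "\<And>i. i \<in> I \<Longrightarrow> A i \<in> sets lborel"
    have *: "(\<lambda>u. u + t i) -` A i \<in> sets lborel" if "i \<in> I" for i
    proof -
      have "(\<lambda>u. u + t i) -` A i \<inter> space lborel \<in> sets lborel"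
        by (rule measurable_sets[of _ lborel lborel]) (use A[OF that] in auto)
      then show ?thesis by simp
    qed
    have shift_eq: "(\<lambda>u. u + t i) = (+) (t i)" for i
      by (auto simp: fun_eq_iff)
    have 1: "emeasure lborel ((\<lambda>u. u + t i) -` A i) = emeasure lborel (A i)" if "i \<in> I" for i
    proof -
      have "emeasure lborel (A i) = emeasure (distr lborel borel (\<lambda>u. t i + u)) (A i)"
        by (simp add: lborel_distr_plus)
      also have "\<dots> = emeasure lborel ((\<lambda>u. u + t i) -` A i)"
        using A[OF that] by (subst emeasure_distr) (auto simp: shift_eq)
      finally show ?thesis by simp
    qed
    have "Pi\<^sub>E I A \<in> sets ?L"
      using A I by (intro sets_PiM_I_finite) auto
    then have "emeasure (distr ?L ?L ?s) (Pi\<^sub>E I A) = emeasure ?L (?s -` Pi\<^sub>E I A \<inter> space ?L)"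
      by (simp add: emeasure_distr)
    also have "?s -` Pi\<^sub>E I A \<inter> space ?L = Pi\<^sub>E I (\<lambda>i. (\<lambda>u. u + t i) -` A i)"
      by (auto simp: space_PiM PiE_iff extensional_def)
    also have "emeasure ?L \<dots> = (\<Prod>i\<in>I. emeasure lborel (A i))"
      by (subst emeasure_PiM) (use I * 1 in auto)
    finally show "emeasure (distr ?L ?L ?s) (Pi\<^sub>E I A) = (\<Prod>i\<in>I. emeasure lborel (A i))" .
  qed simp
  then have "(\<integral>\<^sup>+x. F x \<partial>?L) = (\<integral>\<^sup>+x. F x \<partial>distr ?L ?L ?s)"
    by simp
  also have "\<dots> = (\<integral>\<^sup>+x. F (?s x) \<partial>?L)"
    by (rule nn_integral_distr) measurable
  finally show ?thesis .
qed

definition bform :: "nat \<Rightarrow> real mat \<Rightarrow> (nat \<Rightarrow> real) \<Rightarrow> (nat \<Rightarrow> real) \<Rightarrow> real" where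
  "bform p A u v = (\<Sum>i<p. \<Sum>j<p. u i * A $$ (i, j) * v j)"

lemma bform_scalar_prod:
  assumes "A \<in> carrier_mat p p"
  shows "bform p A u v = vec p u \<bullet> (A *\<^sub>v vec p v)"
  using assms
  by (auto simp: bform_def scalar_prod_def sum_distrib_left mult.assoc lessThan_atLeast0 intro!: sum.cong)

lemma sym_pos_def_det:
  assumes "sym_pos_def p A"
  shows "det A \<noteq> 0"
proof
  assume "det A = 0"
  moreover have A: "A \<in> carrier_mat p p"
    using assms by (simp add: sym_pos_def_def)
  ultimately obtain v where v: "v \<in> carrier_vec p" "v \<noteq> 0\<^sub>v p" "A *\<^sub>v v = 0\<^sub>v p"
    using det_0_iff_vec_prod_zero by blast
  then have "v \<bullet> (A *\<^sub>v v) = 0"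
    by simp
  then show False
    using assms v unfolding sym_pos_def_def by fastforce
qed

text \<open>Completing the square: moving the argument of the Gaussian exponent by \<open>s A a\<close> changes it by a
function of the single number \<open>a \<bullet> y\<close>, because \<open>A\<close> cancels its inverse.\<close>

lemma inv_mat_quadratic_shift:
  assumes spd: "sym_pos_def p A" and y: "y \<in> carrier_vec p" and a: "a \<in> carrier_vec p"
  shows "(y - s \<cdot>\<^sub>v (A *\<^sub>v a)) \<bullet> (inv_mat A *\<^sub>v (y - s \<cdot>\<^sub>v (A *\<^sub>v a))) =
         y \<bullet> (inv_mat A *\<^sub>v y) - 2 * s * (a \<bullet> y) + s\<^sup>2 * (a \<bullet> (A *\<^sub>v a))"
proof -
  have A: "A \<in> carrier_mat p p" and sym: "transpose_mat A = A"
    using spd by (auto simp: sym_pos_def_def)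
  note inv = inv_mat_correct[OF A sym_pos_def_det[OF spd]]
  let ?h = "A *\<^sub>v a" and ?B = "inv_mat A"
  have h: "?h \<in> carrier_vec p" using A a by simp
  have Bh: "?B *\<^sub>v ?h = a"
    using inv A a by (metis assoc_mult_mat_vec one_mult_mat_vec)
  have hB: "?h \<bullet> (?B *\<^sub>v y) = a \<bullet> y"
  proof -
    have "?h \<bullet> (?B *\<^sub>v y) = (?B *\<^sub>v y) \<bullet> (A *\<^sub>v a)"
      using h inv y by (intro comm_scalar_prod[of _ p]) auto
    also have "\<dots> = (transpose_mat A *\<^sub>v (?B *\<^sub>v y)) \<bullet> a"
      using A a inv y by (intro transpose_vec_mult_scalar[symmetric]) auto
    also have "\<dots> = y \<bullet> a"
      using inv A y by (simp add: sym) (metis assoc_mult_mat_vec one_mult_mat_vec)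
    also have "\<dots> = a \<bullet> y"
      using y a by (intro comm_scalar_prod) auto
    finally show ?thesis .
  qed
  have yB: "y \<bullet> a = a \<bullet> y" "?h \<bullet> a = a \<bullet> ?h"
    using y a h by (auto intro!: comm_scalar_prod)
  have sh: "s \<cdot>\<^sub>v ?h \<in> carrier_vec p" using h by simp
  have "?B *\<^sub>v (y - s \<cdot>\<^sub>v ?h) = ?B *\<^sub>v y - s \<cdot>\<^sub>v a"
    using inv y sh h Bh
    by (metis mult_minus_distrib_mat_vec mult_mat_vec)
  moreover have By: "?B *\<^sub>v y \<in> carrier_vec p" using inv y by simp
  ultimately show ?thesis
    using y sh h a
    by (simp add: minus_scalar_prod_distrib[of _ p] scalar_prod_minus_distrib[of _ p] hB yB
        power2_eq_square algebra_simps)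
qed

text \<open>A Cameron-Martin formula. Translating the density by \<open>s A a\<close> shifts the linear functional
\<open>Y\<close> by \<open>s (a \<bullet> A a) = s\<close> and multiplies the density by a function of \<open>Y\<close> alone. Nothing has to be
known about the normalizing constant of the density.\<close>

lemma normal_vec_exponential_tilt:
  fixes \<phi> :: "real \<Rightarrow> ennreal"
  assumes spd: "sym_pos_def p A" and mu: "\<mu> \<in> carrier_vec p"
    and normal: "normal_vec M p \<mu> A X"
    and unit: "bform p A a a = 1"
    and \<phi>[measurable]: "\<phi> \<in> borel_measurable borel"
  defines "Y \<equiv> \<lambda>\<omega>. \<Sum>i<p. a i * (X \<omega> i - \<mu> $ i)"
  shows "(\<integral>\<^sup>+\<omega>. \<phi> (Y \<omega> + s) \<partial>M) = (\<integral>\<^sup>+\<omega>. ennreal (exp (s * Y \<omega> - s\<^sup>2 / 2)) * \<phi> (Y \<omega>) \<partial>M)"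
proof -
  let ?L = "Pi\<^sub>M {..<p} (\<lambda>_. lborel :: real measure)"
  let ?f = "normal_vec_density p \<mu> A"
  let ?Y = "\<lambda>x. \<Sum>i<p. a i * (x i - \<mu> $ i)"
  have A: "A \<in> carrier_mat p p" using spd by (simp add: sym_pos_def_def)
  have D: "distributed M ?L X (\<lambda>x. ennreal (?f x))"
    using normal by (simp add: normal_vec_def)
  have f[measurable]: "(\<lambda>x. ennreal (?f x)) \<in> borel_measurable ?L"
    using D by (rule distributed_borel_measurable)
  define h where "h = A *\<^sub>v vec p a"
  have h: "h \<in> carrier_vec p" using A by (simp add: h_def)
  let ?sh = "\<lambda>x. \<lambda>i\<in>{..<p}. x i + - s * h $ i"
  have Ysh: "?Y (?sh x) = ?Y x - s" for x
  proof -
    have "(\<Sum>i<p. a i * h $ i) = 1"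
      using unit unfolding bform_scalar_prod[OF A] h_def[symmetric]
      using h by (simp add: scalar_prod_def lessThan_atLeast0)
    then have "(\<Sum>i<p. a i * (s * h $ i)) = s"
      by (metis (no_types, lifting) mult.left_commute mult.right_neutral sum.cong sum_distrib_left)
    then show ?thesis
      by (simp add: algebra_simps sum.distrib sum_subtractf)
  qed
  have fsh: "?f (?sh x) = ?f x * exp (s * ?Y x - s\<^sup>2 / 2)" for x
  proof -
    let ?y = "vec p x - \<mu>"
    have 1: "vec p (?sh x) - \<mu> = ?y - s \<cdot>\<^sub>v h"
      using mu h by (intro eq_vecI) auto
    have 2: "(?y - s \<cdot>\<^sub>v h) \<bullet> (inv_mat A *\<^sub>v (?y - s \<cdot>\<^sub>v h)) =
        ?y \<bullet> (inv_mat A *\<^sub>v ?y) - 2 * s * ?Y x + s\<^sup>2"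
    proof -
      have "vec p a \<bullet> ?y = ?Y x"
        using mu by (simp add: scalar_prod_def lessThan_atLeast0)
      then show ?thesis
        using inv_mat_quadratic_shift[OF spd, of ?y "vec p a" s] mu unit
        unfolding h_def bform_scalar_prod[OF A] by simp
    qed
    show ?thesis
      unfolding normal_vec_density_def Let_def 1 2
      by (simp add: exp_add[symmetric] field_simps)
  qed
  have "(\<integral>\<^sup>+\<omega>. \<phi> (Y \<omega> + s) \<partial>M) = (\<integral>\<^sup>+x. ennreal (?f x) * \<phi> (?Y x + s) \<partial>?L)"
    unfolding Y_def by (rule distributed_nn_integral[OF D, symmetric]) measurable
  also have "\<dots> = (\<integral>\<^sup>+x. ennreal (?f (?sh x)) * \<phi> (?Y (?sh x) + s) \<partial>?L)"
    by (rule nn_integral_PiM_lborel_translate) measurable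
  also have "\<dots> = (\<integral>\<^sup>+x. ennreal (?f x) * (ennreal (exp (s * ?Y x - s\<^sup>2 / 2)) * \<phi> (?Y x)) \<partial>?L)"
    unfolding Ysh fsh by (simp add: ennreal_mult'' mult.assoc)
  also have "\<dots> = (\<integral>\<^sup>+\<omega>. ennreal (exp (s * Y \<omega> - s\<^sup>2 / 2)) * \<phi> (Y \<omega>) \<partial>M)"
    unfolding Y_def by (rule distributed_nn_integral[OF D]) measurable
  finally show ?thesis .
qed

text \<open>The integrand is a multiple of the normal density with mean \<open>b / c\<close> and variance \<open>1 / c\<close>.\<close>

lemma nn_integral_exp_quadratic:
  fixes c b :: real
  assumes "c > 0"
  shows "(\<integral>\<^sup>+x. ennreal (exp (b * x - c * x\<^sup>2 / 2)) \<partial>lborel) =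
         ennreal (sqrt (2 * pi / c) * exp (b\<^sup>2 / (2 * c)))"
proof -
  let ?s = "1 / sqrt c"
  have "exp (b * x - c * x\<^sup>2 / 2) =
      sqrt (2 * pi / c) * exp (b\<^sup>2 / (2 * c)) * normal_density (b / c) ?s x" for x
  proof -
    have 1: "sqrt (2 * pi * (1 / sqrt c)\<^sup>2) = sqrt (2 * pi / c)"
      using assms by (simp add: power_divide)
    have 2: "sqrt (2 * pi / c) > 0"
      using assms by simp
    have 3: "b * x - c * x\<^sup>2 / 2 = b\<^sup>2 / (2 * c) + - (x - b / c)\<^sup>2 / (2 * (1 / sqrt c)\<^sup>2)"
      using assms by (simp add: power_divide power2_eq_square field_simps)
    show ?thesis
      unfolding normal_density_def 1 unfolding 3 exp_add using 2 assms by simp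
  qed
  then have "(\<integral>\<^sup>+x. ennreal (exp (b * x - c * x\<^sup>2 / 2)) \<partial>lborel) =
      (\<integral>\<^sup>+x. ennreal (sqrt (2 * pi / c) * exp (b\<^sup>2 / (2 * c))) * ennreal (normal_density (b / c) ?s x) \<partial>lborel)"
    using assms by (simp add: ennreal_mult')
  also have "\<dots> = ennreal (sqrt (2 * pi / c) * exp (b\<^sup>2 / (2 * c)))"
    using prob_space.emeasure_space_1[OF prob_space_normal_density[of ?s "b / c"]] assms
    by (simp add: nn_integral_cmult emeasure_density)
  finally show ?thesis .
qed

text \<open>Integrating the tilt formula over all shifts \<open>s\<close> identifies the law of \<open>Y\<close>: on one side the shift
sweeps out Lebesgue measure, on the other side the tilt integrates to \<open>\<surd>(2 \<pi>) exp (Y\<^sup>2 / 2)\<close>, which is the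
reciprocal of the standard normal density at \<open>Y\<close>. The test function below carries that density as a factor, so
that the two cancel.\<close>

lemma normal_vec_linear_std_normal:
  fixes \<psi> :: "real \<Rightarrow> ennreal"
  assumes M: "prob_space M" and spd: "sym_pos_def p A" and mu: "\<mu> \<in> carrier_vec p"
    and normal: "normal_vec M p \<mu> A X"
    and unit: "bform p A a a = 1"
    and \<psi>[measurable]: "\<psi> \<in> borel_measurable borel"
  defines "Y \<equiv> \<lambda>\<omega>. \<Sum>i<p. a i * (X \<omega> i - \<mu> $ i)"
  shows "(\<integral>\<^sup>+\<omega>. \<psi> (Y \<omega>) \<partial>M) = (\<integral>\<^sup>+x. ennreal (std_normal_density x) * \<psi> x \<partial>lborel)"
proof -
  interpret prob_space M by fact
  interpret pair_sigma_finite M "lborel :: real measure" ..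
  have X[measurable]: "X \<in> measurable M (Pi\<^sub>M {..<p} (\<lambda>_. lborel :: real measure))"
    using normal unfolding normal_vec_def by (rule distributed_measurable)
  have Y[measurable]: "Y \<in> borel_measurable M"
    unfolding Y_def
    by (intro borel_measurable_sum borel_measurable_times borel_measurable_diff borel_measurable_const)
       (use measurable_compose[OF X measurable_component_singleton] in auto)
  define \<phi> where "\<phi> x = ennreal (std_normal_density x) * \<psi> x" for x
  have \<phi>[measurable]: "\<phi> \<in> borel_measurable borel"
    unfolding \<phi>_def by measurable
  have "(\<integral>\<^sup>+x. \<phi> x \<partial>lborel) = (\<integral>\<^sup>+\<omega>. (\<integral>\<^sup>+s. \<phi> (Y \<omega> + s) \<partial>lborel) \<partial>M)"
  proof -
    have "(\<integral>\<^sup>+s. \<phi> (y + s) \<partial>lborel) = (\<integral>\<^sup>+x. \<phi> x \<partial>lborel)" for y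
      using nn_integral_real_affine[of \<phi> 1 y] by simp
    then show ?thesis by (simp add: emeasure_space_1)
  qed
  also have "\<dots> = (\<integral>\<^sup>+s. (\<integral>\<^sup>+\<omega>. \<phi> (Y \<omega> + s) \<partial>M) \<partial>lborel)"
    by (rule Fubini'[symmetric]) measurable
  also have "\<dots> = (\<integral>\<^sup>+s. (\<integral>\<^sup>+\<omega>. ennreal (exp (s * Y \<omega> - s\<^sup>2 / 2)) * \<phi> (Y \<omega>) \<partial>M) \<partial>lborel)"
    unfolding Y_def by (subst normal_vec_exponential_tilt[OF spd mu normal unit \<phi>]) simp
  also have "\<dots> = (\<integral>\<^sup>+\<omega>. (\<integral>\<^sup>+s. ennreal (exp (s * Y \<omega> - s\<^sup>2 / 2)) * \<phi> (Y \<omega>) \<partial>lborel) \<partial>M)"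
    by (rule Fubini') measurable
  also have "\<dots> = (\<integral>\<^sup>+\<omega>. \<psi> (Y \<omega>) \<partial>M)"
  proof (rule nn_integral_cong)
    fix \<omega>
    have "(\<integral>\<^sup>+s. ennreal (exp (s * Y \<omega> - s\<^sup>2 / 2)) * \<phi> (Y \<omega>) \<partial>lborel) =
        ennreal (sqrt (2 * pi) * exp ((Y \<omega>)\<^sup>2 / 2)) * \<phi> (Y \<omega>)"
      using nn_integral_exp_quadratic[of 1 "Y \<omega>"] by (subst nn_integral_multc) (auto simp: mult.commute)
    also have "\<dots> = ennreal (sqrt (2 * pi) * exp ((Y \<omega>)\<^sup>2 / 2) * std_normal_density (Y \<omega>)) * \<psi> (Y \<omega>)"
      by (simp add: \<phi>_def ennreal_mult' mult.assoc)
    also have "sqrt (2 * pi) * exp ((Y \<omega>)\<^sup>2 / 2) * std_normal_density (Y \<omega>) = 1"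
      by (simp add: std_normal_density_def exp_add[symmetric])
    finally show "(\<integral>\<^sup>+s. ennreal (exp (s * Y \<omega> - s\<^sup>2 / 2)) * \<phi> (Y \<omega>) \<partial>lborel) = \<psi> (Y \<omega>)"
      by simp
  qed
  finally show ?thesis by (simp add: \<phi>_def)
qed

lemma normal_vec_linear_distributed:
  assumes M: "prob_space M" and spd: "sym_pos_def p A" and mu: "\<mu> \<in> carrier_vec p"
    and normal: "normal_vec M p \<mu> A X"
    and unit: "bform p A a a = 1"
  shows "distributed M lborel (\<lambda>\<omega>. \<Sum>i<p. a i * (X \<omega> i - \<mu> $ i)) std_normal_density"
proof -
  let ?Y = "\<lambda>\<omega>. \<Sum>i<p. a i * (X \<omega> i - \<mu> $ i)"
  have X: "X \<in> measurable M (Pi\<^sub>M {..<p} (\<lambda>_. lborel :: real measure))"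
    using normal unfolding normal_vec_def by (rule distributed_measurable)
  have Y: "?Y \<in> borel_measurable M"
    by (intro borel_measurable_sum borel_measurable_times borel_measurable_diff borel_measurable_const)
       (use measurable_compose[OF X measurable_component_singleton] in auto)
  have "distr M lborel ?Y = density lborel std_normal_density"
  proof (rule measure_eqI)
    fix B :: "real set" assume "B \<in> sets (distr M lborel ?Y)"
    then have B[measurable]: "B \<in> sets borel" by simp
    have "emeasure (distr M lborel ?Y) B = (\<integral>\<^sup>+x. indicator B x \<partial>distr M lborel ?Y)"
      by simp
    also have "\<dots> = (\<integral>\<^sup>+\<omega>. indicator B (?Y \<omega>) \<partial>M)"
      using Y by (intro nn_integral_distr) auto
    also have "\<dots> = emeasure (density lborel std_normal_density) B"
      by (subst normal_vec_linear_std_normal[OF M spd mu normal unit]) (auto simp: emeasure_density)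
    finally show "emeasure (distr M lborel ?Y) B = emeasure (density lborel std_normal_density) B" .
  qed simp
  then show ?thesis
    using Y by (simp add: distributed_def)
qed

section \<open>Chi-square moment generating functions and tails\<close>

text \<open>The sum of squared deviations from the mean, expanded so that the sum of squares and the square of the sum
can be treated separately.\<close>
definition centered_sum_squares :: "nat \<Rightarrow> (nat \<Rightarrow> real) \<Rightarrow> real" where
  "centered_sum_squares n y = (\<Sum>k<n. (y k)\<^sup>2) - (\<Sum>k<n. y k)\<^sup>2 / real n"

context prob_space begin

lemma std_normal_exp_quadratic:
  assumes D: "distributed M lborel Y std_normal_density" and l: "1 + 2 * l > 0"
  shows "(\<integral>\<^sup>+\<omega>. ennreal (exp (b * Y \<omega> - l * (Y \<omega>)\<^sup>2)) \<partial>M) =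
         ennreal ((1 + 2 * l) powr (- 1 / 2) * exp (b\<^sup>2 / (2 * (1 + 2 * l))))"
proof -
  have "(\<integral>\<^sup>+\<omega>. ennreal (exp (b * Y \<omega> - l * (Y \<omega>)\<^sup>2)) \<partial>M) =
      (\<integral>\<^sup>+x. ennreal (std_normal_density x) * ennreal (exp (b * x - l * x\<^sup>2)) \<partial>lborel)"
    by (rule distributed_nn_integral[OF D, symmetric]) measurable
  also have "\<dots> = (\<integral>\<^sup>+x. ennreal (1 / sqrt (2 * pi)) * ennreal (exp (b * x - (1 + 2 * l) * x\<^sup>2 / 2)) \<partial>lborel)"
  proof (rule nn_integral_cong)
    fix x :: real
    have "std_normal_density x * exp (b * x - l * x\<^sup>2) =
        1 / sqrt (2 * pi) * exp (b * x - (1 + 2 * l) * x\<^sup>2 / 2)"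
      unfolding std_normal_density_def mult.assoc exp_add[symmetric]
      by (simp add: algebra_simps add_divide_distrib)
    then show "ennreal (std_normal_density x) * ennreal (exp (b * x - l * x\<^sup>2)) =
        ennreal (1 / sqrt (2 * pi)) * ennreal (exp (b * x - (1 + 2 * l) * x\<^sup>2 / 2))"
      by (metis ennreal_mult' normal_density_nonneg divide_nonneg_nonneg real_sqrt_ge_0_iff
          pi_ge_zero mult_nonneg_nonneg zero_le_numeral zero_le_one)
  qed
  also have "\<dots> = ennreal (1 / sqrt (2 * pi) * (sqrt (2 * pi / (1 + 2 * l)) * exp (b\<^sup>2 / (2 * (1 + 2 * l)))))"
    using l by (subst nn_integral_cmult) (auto simp: nn_integral_exp_quadratic simp flip: ennreal_mult')
  also have "1 / sqrt (2 * pi) * (sqrt (2 * pi / (1 + 2 * l)) * exp (b\<^sup>2 / (2 * (1 + 2 * l)))) =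
      (1 + 2 * l) powr (- 1 / 2) * exp (b\<^sup>2 / (2 * (1 + 2 * l)))"
    using l by (simp add: real_sqrt_divide powr_minus_divide powr_half_sqrt)
  finally show ?thesis .
qed

lemma sum_squares_mgf:
  fixes Y :: "nat \<Rightarrow> 'a \<Rightarrow> real"
  assumes ind: "indep_vars (\<lambda>_. borel) Y {..<n}"
    and D: "\<And>k. k < n \<Longrightarrow> distributed M lborel (Y k) std_normal_density"
    and l: "1 - 2 * l > 0"
  shows "(\<integral>\<^sup>+\<omega>. ennreal (exp (l * (\<Sum>k<n. (Y k \<omega>)\<^sup>2))) \<partial>M) = ennreal ((1 - 2 * l) powr (- real n / 2))"
proof -
  have "(\<integral>\<^sup>+\<omega>. ennreal (exp (l * (\<Sum>k<n. (Y k \<omega>)\<^sup>2))) \<partial>M) =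
      (\<integral>\<^sup>+\<omega>. (\<Prod>k<n. ennreal (exp (l * (Y k \<omega>)\<^sup>2))) \<partial>M)"
    by (simp add: sum_distrib_left exp_sum prod_ennreal)
  also have "\<dots> = (\<Prod>k<n. \<integral>\<^sup>+\<omega>. ennreal (exp (l * (Y k \<omega>)\<^sup>2)) \<partial>M)"
    by (rule indep_vars_nn_integral)
       (auto intro!: indep_vars_compose2[OF ind, of "\<lambda>_ y. ennreal (exp (l * y\<^sup>2))"])
  also have "\<dots> = (\<Prod>k<n. ennreal ((1 - 2 * l) powr (- 1 / 2)))"
  proof (rule prod.cong)
    fix k assume "k \<in> {..<n}"
    then show "(\<integral>\<^sup>+\<omega>. ennreal (exp (l * (Y k \<omega>)\<^sup>2)) \<partial>M) = ennreal ((1 - 2 * l) powr (- 1 / 2))"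
      using std_normal_exp_quadratic[OF D[of k], of "-l" 0] l by simp
  qed simp
  also have "\<dots> = ennreal ((1 - 2 * l) powr (- real n / 2))"
    using l by (simp add: ennreal_power powr_power)
  finally show ?thesis .
qed

text \<open>This is the transform of the chi-square law with \<open>n - 1\<close> degrees of freedom. The square of the sum prevents the
exponential from factorizing, but \<open>exp (l (\<Sum>y)\<^sup>2 / n)\<close> is the mean of \<open>exp (\<beta> h \<Sum>y)\<close> over an
independent standard normal \<open>h\<close>, with \<open>\<beta>\<^sup>2 = 2 l / n\<close>. For fixed \<open>h\<close> the integrand is a product over the
sample, and the remaining Gaussian integral over \<open>h\<close> gives back one factor \<open>\<surd>(1 + 2 l)\<close>.\<close>

lemma centered_sum_squares_mgf:
  fixes Y :: "nat \<Rightarrow> 'a \<Rightarrow> real"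
  assumes ind: "indep_vars (\<lambda>_. borel) Y {..<n}"
    and D: "\<And>k. k < n \<Longrightarrow> distributed M lborel (Y k) std_normal_density"
    and l: "l \<ge> 0" and n: "n > 0"
  shows "(\<integral>\<^sup>+\<omega>. ennreal (exp (- l * centered_sum_squares n (\<lambda>k. Y k \<omega>))) \<partial>M) =
         ennreal ((1 + 2 * l) powr (- (real n - 1) / 2))"
proof -
  interpret pair_sigma_finite M "lborel :: real measure" ..
  have Y: "Y k \<in> borel_measurable M" if "k < n" for k
    using distributed_measurable[OF D[OF that]] by simp
  define \<beta> where "\<beta> = sqrt (2 * l / n)"
  define S where "S \<omega> = (\<Sum>k<n. Y k \<omega>)" for \<omega>
  define Q where "Q \<omega> = (\<Sum>k<n. (Y k \<omega>)\<^sup>2)" for \<omega>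
  have [measurable]: "S \<in> borel_measurable M" "Q \<in> borel_measurable M"
    unfolding S_def[abs_def] Q_def[abs_def]
    by (intro borel_measurable_sum borel_measurable_power Y; simp)+
  have \<beta>2: "\<beta>\<^sup>2 = 2 * l / n"
    using l by (simp add: \<beta>_def)
  let ?r = "(1 + 2 * l) powr (- 1 / 2)"
  have lin: "ennreal (exp (- l * centered_sum_squares n (\<lambda>k. Y k \<omega>))) =
      (\<integral>\<^sup>+h. ennreal (1 / sqrt (2 * pi)) * ennreal (exp (\<beta> * S \<omega> * h - h\<^sup>2 / 2 - l * Q \<omega>)) \<partial>lborel)" for \<omega>
  proof -
    have "(\<integral>\<^sup>+h. ennreal (1 / sqrt (2 * pi)) * ennreal (exp (\<beta> * S \<omega> * h - h\<^sup>2 / 2 - l * Q \<omega>)) \<partial>lborel) =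
        (\<integral>\<^sup>+h. ennreal (1 / sqrt (2 * pi) * exp (- l * Q \<omega>)) * ennreal (exp ((\<beta> * S \<omega>) * h - 1 * h\<^sup>2 / 2)) \<partial>lborel)"
    proof (rule nn_integral_cong)
      fix h :: real
      have "exp (\<beta> * S \<omega> * h - h\<^sup>2 / 2 - l * Q \<omega>) = exp (- l * Q \<omega>) * exp ((\<beta> * S \<omega>) * h - 1 * h\<^sup>2 / 2)"
        by (simp add: exp_add[symmetric])
      then show "ennreal (1 / sqrt (2 * pi)) * ennreal (exp (\<beta> * S \<omega> * h - h\<^sup>2 / 2 - l * Q \<omega>)) =
          ennreal (1 / sqrt (2 * pi) * exp (- l * Q \<omega>)) * ennreal (exp ((\<beta> * S \<omega>) * h - 1 * h\<^sup>2 / 2))"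
        by (simp flip: ennreal_mult')
    qed
    also have "\<dots> = ennreal (1 / sqrt (2 * pi) * exp (- l * Q \<omega>) * (sqrt (2 * pi / 1) * exp ((\<beta> * S \<omega>)\<^sup>2 / (2 * 1))))"
      by (subst nn_integral_cmult, simp, subst nn_integral_exp_quadratic) (simp_all flip: ennreal_mult')
    also have "1 / sqrt (2 * pi) * exp (- l * Q \<omega>) * (sqrt (2 * pi / 1) * exp ((\<beta> * S \<omega>)\<^sup>2 / (2 * 1)))
        = exp (- l * Q \<omega> + (\<beta> * S \<omega>)\<^sup>2 / 2)"
      by (simp add: mult_exp_exp)
    also have "- l * Q \<omega> + (\<beta> * S \<omega>)\<^sup>2 / 2 = - l * centered_sum_squares n (\<lambda>k. Y k \<omega>)"
      unfolding power_mult_distrib \<beta>2 centered_sum_squares_def S_def Q_def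
      by (simp add: field_simps)
    finally show ?thesis by simp
  qed
  have inner: "(\<integral>\<^sup>+\<omega>. ennreal (exp (\<beta> * S \<omega> * h - h\<^sup>2 / 2 - l * Q \<omega>)) \<partial>M) =
      ennreal ((1 + 2 * l) powr (- real n / 2)) * ennreal (exp (0 * h - (1 / (1 + 2 * l)) * h\<^sup>2 / 2))" for h
  proof -
    have "(\<integral>\<^sup>+\<omega>. ennreal (exp (\<beta> * S \<omega> * h - h\<^sup>2 / 2 - l * Q \<omega>)) \<partial>M) =
        (\<integral>\<^sup>+\<omega>. ennreal (exp (- h\<^sup>2 / 2)) * (\<Prod>k<n. ennreal (exp (\<beta> * h * Y k \<omega> - l * (Y k \<omega>)\<^sup>2))) \<partial>M)"
    proof (rule nn_integral_cong)
      fix \<omega>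
      have "exp (\<beta> * S \<omega> * h - h\<^sup>2 / 2 - l * Q \<omega>) =
          exp (- h\<^sup>2 / 2) * (\<Prod>k<n. exp (\<beta> * h * Y k \<omega> - l * (Y k \<omega>)\<^sup>2))"
        unfolding exp_sum[OF finite_lessThan, symmetric] exp_add[symmetric] S_def Q_def
        by (simp add: sum_subtractf sum_distrib_left sum_distrib_right algebra_simps)
      then show "ennreal (exp (\<beta> * S \<omega> * h - h\<^sup>2 / 2 - l * Q \<omega>)) =
          ennreal (exp (- h\<^sup>2 / 2)) * (\<Prod>k<n. ennreal (exp (\<beta> * h * Y k \<omega> - l * (Y k \<omega>)\<^sup>2)))"
        by (simp add: prod_ennreal prod_nonneg ennreal_mult')
    qed
    also have "\<dots> = ennreal (exp (- h\<^sup>2 / 2)) *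
        (\<integral>\<^sup>+\<omega>. (\<Prod>k<n. ennreal (exp (\<beta> * h * Y k \<omega> - l * (Y k \<omega>)\<^sup>2))) \<partial>M)"
      using Y by (intro nn_integral_cmult borel_measurable_prod_ennreal) auto
    also have "(\<integral>\<^sup>+\<omega>. (\<Prod>k<n. ennreal (exp (\<beta> * h * Y k \<omega> - l * (Y k \<omega>)\<^sup>2))) \<partial>M) =
        (\<Prod>k<n. \<integral>\<^sup>+\<omega>. ennreal (exp (\<beta> * h * Y k \<omega> - l * (Y k \<omega>)\<^sup>2)) \<partial>M)"
      by (rule indep_vars_nn_integral)
         (auto intro!: indep_vars_compose2[OF ind, of "\<lambda>_ y. ennreal (exp (\<beta> * h * y - l * y\<^sup>2))"])
    also have "\<dots> = (\<Prod>k<n. ennreal (?r * exp ((\<beta> * h)\<^sup>2 / (2 * (1 + 2 * l)))))"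
      using std_normal_exp_quadratic[OF D, of _ l "\<beta> * h"] l by (intro prod.cong) auto
    also have "\<dots> = ennreal ((1 + 2 * l) powr (- real n / 2) * exp (real n * ((\<beta> * h)\<^sup>2 / (2 * (1 + 2 * l)))))"
      using l by (simp add: ennreal_power powr_power power_mult_distrib exp_of_nat_mult[symmetric])
    also have "ennreal (exp (- h\<^sup>2 / 2)) * \<dots> =
        ennreal ((1 + 2 * l) powr (- real n / 2) * exp (- h\<^sup>2 / 2 + real n * ((\<beta> * h)\<^sup>2 / (2 * (1 + 2 * l)))))"
      by (simp add: ennreal_mult'[symmetric] mult_exp_exp)
    also have "- h\<^sup>2 / 2 + real n * ((\<beta> * h)\<^sup>2 / (2 * (1 + 2 * l))) = 0 * h - (1 / (1 + 2 * l)) * h\<^sup>2 / 2"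
    proof -
      have "1 + 2 * l \<noteq> 0" using l by simp
      then show ?thesis
        unfolding power_mult_distrib \<beta>2 using n by (simp add: divide_simps) (simp add: algebra_simps)
    qed
    finally show ?thesis by (simp add: ennreal_mult')
  qed
  have "(\<integral>\<^sup>+\<omega>. ennreal (exp (- l * centered_sum_squares n (\<lambda>k. Y k \<omega>))) \<partial>M) =
      (\<integral>\<^sup>+\<omega>. (\<integral>\<^sup>+h. ennreal (1 / sqrt (2 * pi)) * ennreal (exp (\<beta> * S \<omega> * h - h\<^sup>2 / 2 - l * Q \<omega>)) \<partial>lborel) \<partial>M)"
    by (simp only: lin)
  also have "\<dots> = (\<integral>\<^sup>+h. (\<integral>\<^sup>+\<omega>. ennreal (1 / sqrt (2 * pi)) * ennreal (exp (\<beta> * S \<omega> * h - h\<^sup>2 / 2 - l * Q \<omega>)) \<partial>M) \<partial>lborel)"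
    by (rule Fubini'[symmetric]) measurable
  also have "\<dots> = (\<integral>\<^sup>+h. ennreal (1 / sqrt (2 * pi)) * (ennreal ((1 + 2 * l) powr (- real n / 2)) *
      ennreal (exp (0 * h - (1 / (1 + 2 * l)) * h\<^sup>2 / 2))) \<partial>lborel)"
  proof (rule nn_integral_cong)
    fix h :: real
    have "(\<integral>\<^sup>+\<omega>. ennreal (1 / sqrt (2 * pi)) * ennreal (exp (\<beta> * S \<omega> * h - h\<^sup>2 / 2 - l * Q \<omega>)) \<partial>M) =
        ennreal (1 / sqrt (2 * pi)) * (\<integral>\<^sup>+\<omega>. ennreal (exp (\<beta> * S \<omega> * h - h\<^sup>2 / 2 - l * Q \<omega>)) \<partial>M)"
      by (rule nn_integral_cmult) measurable
    then show "(\<integral>\<^sup>+\<omega>. ennreal (1 / sqrt (2 * pi)) * ennreal (exp (\<beta> * S \<omega> * h - h\<^sup>2 / 2 - l * Q \<omega>)) \<partial>M) =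
        ennreal (1 / sqrt (2 * pi)) * (ennreal ((1 + 2 * l) powr (- real n / 2)) *
          ennreal (exp (0 * h - (1 / (1 + 2 * l)) * h\<^sup>2 / 2)))"
      by (simp only: inner)
  qed
  also have "\<dots> = ennreal (1 / sqrt (2 * pi)) * (ennreal ((1 + 2 * l) powr (- real n / 2)) *
      ennreal (sqrt (2 * pi / (1 / (1 + 2 * l)))))"
    using l by (subst nn_integral_cmult, simp, subst nn_integral_cmult, simp, subst nn_integral_exp_quadratic) simp_all
  also have "\<dots> = ennreal (1 / sqrt (2 * pi) * ((1 + 2 * l) powr (- real n / 2) * sqrt (2 * pi * (1 + 2 * l))))"
    by (simp add: ennreal_mult'[symmetric])
  also have "1 / sqrt (2 * pi) * ((1 + 2 * l) powr (- real n / 2) * sqrt (2 * pi * (1 + 2 * l))) =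
      (1 + 2 * l) powr (- (real n - 1) / 2)"
  proof -
    have "(1 + 2 * l) powr (- (real n - 1) / 2) = (1 + 2 * l) powr (- real n / 2 + 1 / 2)"
      by (simp add: diff_divide_distrib)
    also have "\<dots> = (1 + 2 * l) powr (- real n / 2) * sqrt (1 + 2 * l)"
      using l by (simp only: powr_add) (simp add: powr_half_sqrt)
    finally show ?thesis
      using l by (simp add: real_sqrt_mult)
  qed
  finally show ?thesis .
qed

text \<open>Markov's inequality for \<open>exp Z\<close>; every tail bound below comes from a choice of \<open>Z\<close>.\<close>

lemma exponential_markov:
  assumes [measurable]: "Z \<in> borel_measurable M"
    and B: "(\<integral>\<^sup>+\<omega>. ennreal (exp (Z \<omega>)) \<partial>M) \<le> ennreal B" "B \<ge> 0"
  shows "prob {\<omega> \<in> space M. t \<le> Z \<omega>} \<le> exp (- t) * B"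
proof -
  have "emeasure M {\<omega> \<in> space M. t \<le> Z \<omega>} \<le>
      emeasure M {\<omega> \<in> space M. 1 \<le> ennreal (exp (- t)) * ennreal (exp (Z \<omega>))}"
    by (intro emeasure_mono) (auto simp: ennreal_mult'[symmetric] exp_add[symmetric])
  also have "\<dots> \<le> ennreal (exp (- t)) * (\<integral>\<^sup>+\<omega>. ennreal (exp (Z \<omega>)) * indicator (space M) \<omega> \<partial>M)"
    by (rule nn_integral_Markov_inequality) auto
  also have "(\<integral>\<^sup>+\<omega>. ennreal (exp (Z \<omega>)) * indicator (space M) \<omega> \<partial>M) = (\<integral>\<^sup>+\<omega>. ennreal (exp (Z \<omega>)) \<partial>M)"
    by (intro nn_integral_cong) auto
  also have "ennreal (exp (- t)) * \<dots> \<le> ennreal (exp (- t) * B)"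
    using B by (simp add: ennreal_mult mult_left_mono)
  finally show ?thesis
    using B(2) by (simp add: emeasure_eq_measure)
qed

text \<open>Chernoff bounds with parameter \<open>l = b \<surd>(x / n)\<close>, which makes all terms of the exponent multiples of \<open>x\<close>; the
condition on \<open>b\<close> keeps \<open>l\<close> where \<open>ln (1 - 2 l)\<close> is quadratically close to \<open>- 2 l\<close>. The choice of \<open>K\<close>
makes the linear term beat the quadratic one by \<open>A x\<close>. In the upper tail the centred sum of squares
is replaced by the larger uncentred one. The price is a summand \<open>l\<close>, which \<open>x \<ge> 1\<close> absorbs.\<close>

lemma centered_sum_squares_deviation:
  fixes Y :: "nat \<Rightarrow> 'a \<Rightarrow> real"
  assumes ind: "indep_vars (\<lambda>_. borel) Y {..<n}"
    and D: "\<And>k. k < n \<Longrightarrow> distributed M lborel (Y k) std_normal_density"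
    and n: "n \<ge> 2" and x: "x \<ge> 1" and b: "b > 0" "b * sqrt (x / n) \<le> 1 / 4"
    and K: "K = 2 / b * (A + 4 * b\<^sup>2 + 1)" and A: "A \<ge> 0"
  shows "prob {\<omega> \<in> space M. \<not> \<bar>centered_sum_squares n (\<lambda>k. Y k \<omega>) / (real n - 1) - 1\<bar> \<le> K * sqrt (x / n)}
    \<le> 2 * exp (- A * x)"
proof -
  have Y: "Y k \<in> borel_measurable M" if "k < n" for k
    using distributed_measurable[OF D[OF that]] by simp
  define Q where "Q \<omega> = (\<Sum>k<n. (Y k \<omega>)\<^sup>2)" for \<omega>
  define C where "C \<omega> = centered_sum_squares n (\<lambda>k. Y k \<omega>)" for \<omega>
  have meas[measurable]: "Q \<in> borel_measurable M" "C \<in> borel_measurable M"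
    unfolding Q_def[abs_def] C_def[abs_def] centered_sum_squares_def
    by (intro borel_measurable_sum borel_measurable_power borel_measurable_diff
        borel_measurable_divide borel_measurable_const Y; simp)+
  have CQ: "C \<omega> \<le> Q \<omega>" for \<omega>
    by (simp add: C_def Q_def centered_sum_squares_def)
  define u where "u = sqrt (x / n)"
  define l where "l = b * u"
  define \<tau> where "\<tau> = K * u"
  have u2: "real n * u\<^sup>2 = x"
    using x n by (simp add: u_def)
  have l0: "0 < l" "l \<le> 1 / 4"
    using b x n by (auto simp: l_def u_def)
  have nl2: "real n * l\<^sup>2 = b\<^sup>2 * x"
    unfolding l_def power_mult_distrib using u2 by (metis mult.left_commute)
  have bK: "b * K = 2 * (A + 4 * b\<^sup>2 + 1)"
    using b by (simp add: K)
  have nlt: "real n * (l * \<tau>) = b * K * x"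
    using u2 unfolding l_def \<tau>_def power2_eq_square by (metis mult.left_commute mult.assoc)
  have K0: "0 \<le> b * K * x"
    unfolding bK using A x by simp
  have lt0: "0 \<le> l * \<tau>"
  proof (rule ccontr)
    assume "\<not> 0 \<le> l * \<tau>"
    then have "real n * (l * \<tau>) < 0"
      using n by (intro mult_pos_neg[of "real n" "l * \<tau>"]) auto
    then show False using nlt K0 by simp
  qed
  have half: "(A + 4 * b\<^sup>2 + 1) * x \<le> (real n - 1) * (l * \<tau>)"
  proof -
    have "real n / 2 * (l * \<tau>) \<le> (real n - 1) * (l * \<tau>)"
      using n lt0 by (intro mult_right_mono) auto
    moreover have "real n * (l * \<tau>) = 2 * ((A + 4 * b\<^sup>2 + 1) * x)"
      using nlt bK by (simp only: mult.assoc)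
    ultimately show ?thesis by linarith
  qed
  have upper: "prob {\<omega> \<in> space M. l * ((real n - 1) * (1 + \<tau>)) \<le> l * Q \<omega>} \<le> exp (- A * x)"
  proof -
    have "prob {\<omega> \<in> space M. l * ((real n - 1) * (1 + \<tau>)) \<le> l * Q \<omega>} \<le>
        exp (- (l * ((real n - 1) * (1 + \<tau>)))) * (1 - 2 * l) powr (- real n / 2)"
      by (rule exponential_markov) (use l0 sum_squares_mgf[OF ind D, of l, folded Q_def] in auto)
    also have "(1 - 2 * l) powr (- real n / 2) \<le> exp (real n * (l + 4 * l\<^sup>2))"
    proof -
      have "- (2 * l) - 2 * (2 * l)\<^sup>2 \<le> ln (1 - 2 * l)"
        using l0 by (intro ln_one_minus_pos_lower_bound) auto
      then have "real n / 2 * (- (2 * l) - 2 * (2 * l)\<^sup>2) \<le> real n / 2 * ln (1 - 2 * l)"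
        by (intro mult_left_mono) auto
      then have "- real n / 2 * ln (1 - 2 * l) \<le> real n * (l + 4 * l\<^sup>2)"
        by (simp add: algebra_simps power2_eq_square)
      then show ?thesis using l0 by (simp add: powr_def)
    qed
    also have "exp (- (l * ((real n - 1) * (1 + \<tau>)))) * exp (real n * (l + 4 * l\<^sup>2)) =
        exp (l + 4 * (real n * l\<^sup>2) - (real n - 1) * (l * \<tau>))"
      unfolding exp_add[symmetric] by (simp add: algebra_simps)
    also have "\<dots> \<le> exp (- A * x)"
      using half nl2 l0 x by (simp add: algebra_simps)
    finally show ?thesis by (simp add: mult_left_mono)
  qed
  have lower: "prob {\<omega> \<in> space M. - (l * ((real n - 1) * (1 - \<tau>))) \<le> - l * C \<omega>} \<le> exp (- A * x)"
  proof -
    have "prob {\<omega> \<in> space M. - (l * ((real n - 1) * (1 - \<tau>))) \<le> - l * C \<omega>} \<le>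
        exp (- (- (l * ((real n - 1) * (1 - \<tau>))))) * (1 + 2 * l) powr (- (real n - 1) / 2)"
      by (rule exponential_markov) (use l0 n centered_sum_squares_mgf[OF ind D, of l, folded C_def] in auto)
    also have "(1 + 2 * l) powr (- (real n - 1) / 2) \<le> exp ((real n - 1) * (2 * l\<^sup>2 - l))"
    proof -
      have "2 * l - (2 * l)\<^sup>2 \<le> ln (1 + 2 * l)"
        using l0 by (intro ln_one_plus_pos_lower_bound) auto
      then have *: "(real n - 1) / 2 * (2 * l - (2 * l)\<^sup>2) \<le> (real n - 1) / 2 * ln (1 + 2 * l)"
        using n by (intro mult_left_mono) auto
      have "- N / 2 * L \<le> N * (2 * l\<^sup>2 - l)" if "N / 2 * (2 * l - (2 * l)\<^sup>2) \<le> N / 2 * L" for N L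
        using that by (simp add: algebra_simps power2_eq_square)
      from this[OF *] have "- (real n - 1) / 2 * ln (1 + 2 * l) \<le> (real n - 1) * (2 * l\<^sup>2 - l)" .
      then show ?thesis using l0 by (simp add: powr_def)
    qed
    also have "exp (- (- (l * ((real n - 1) * (1 - \<tau>))))) * exp ((real n - 1) * (2 * l\<^sup>2 - l)) =
        exp (2 * (real n * l\<^sup>2) - 2 * l\<^sup>2 - (real n - 1) * (l * \<tau>))"
      unfolding exp_add[symmetric] by (simp add: algebra_simps)
    also have "\<dots> \<le> exp (- A * x)"
    proof -
      have "0 \<le> b\<^sup>2 * x" "0 \<le> l\<^sup>2" using x by simp_all
      moreover have "(A + 4 * b\<^sup>2 + 1) * x = A * x + 4 * (b\<^sup>2 * x) + x"
        by (simp add: algebra_simps)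
      ultimately show ?thesis
        unfolding exp_le_cancel_iff using half nl2 x by linarith
    qed
    finally show ?thesis by (simp add: mult_left_mono)
  qed
  have "{\<omega> \<in> space M. \<not> \<bar>C \<omega> / (real n - 1) - 1\<bar> \<le> \<tau>} \<subseteq>
      {\<omega> \<in> space M. l * ((real n - 1) * (1 + \<tau>)) \<le> l * Q \<omega>} \<union>
      {\<omega> \<in> space M. - (l * ((real n - 1) * (1 - \<tau>))) \<le> - l * C \<omega>}"
  proof
    fix \<omega> assume *: "\<omega> \<in> {\<omega> \<in> space M. \<not> \<bar>C \<omega> / (real n - 1) - 1\<bar> \<le> \<tau>}"
    then consider "1 + \<tau> < C \<omega> / (real n - 1)" | "C \<omega> / (real n - 1) < 1 - \<tau>"
      by auto argo
    then show "\<omega> \<in> {\<omega> \<in> space M. l * ((real n - 1) * (1 + \<tau>)) \<le> l * Q \<omega>} \<union>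
      {\<omega> \<in> space M. - (l * ((real n - 1) * (1 - \<tau>))) \<le> - l * C \<omega>}"
    proof cases
      case 1
      then have "(real n - 1) * (1 + \<tau>) < C \<omega>"
        using n by (simp add: pos_less_divide_eq mult.commute)
      then have "(real n - 1) * (1 + \<tau>) \<le> Q \<omega>" using CQ[of \<omega>] by linarith
      then show ?thesis using * l0 by auto
    next
      case 2
      then have "C \<omega> < (real n - 1) * (1 - \<tau>)"
        using n by (simp add: pos_divide_less_eq mult.commute)
      then show ?thesis using * l0 by auto
    qed
  qed
  then have "prob {\<omega> \<in> space M. \<not> \<bar>C \<omega> / (real n - 1) - 1\<bar> \<le> \<tau>} \<le>
      prob ({\<omega> \<in> space M. l * ((real n - 1) * (1 + \<tau>)) \<le> l * Q \<omega>} \<union>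
      {\<omega> \<in> space M. - (l * ((real n - 1) * (1 - \<tau>))) \<le> - l * C \<omega>})"
    by (intro finite_measure_mono) auto
  also have "\<dots> \<le> prob {\<omega> \<in> space M. l * ((real n - 1) * (1 + \<tau>)) \<le> l * Q \<omega>} +
      prob {\<omega> \<in> space M. - (l * ((real n - 1) * (1 - \<tau>))) \<le> - l * C \<omega>}"
    by (intro measure_Un_le) auto
  also have "\<dots> \<le> 2 * exp (- A * x)"
    using upper lower by simp
  finally show ?thesis
    by (simp add: C_def \<tau>_def u_def)
qed

text \<open>Here the Chernoff parameter is \<open>l = 1 / c\<close>, so that \<open>1 + 2 l = exp (4 (A + 1))\<close>: the moment generating function
decays like \<open>exp (- 2 (A + 1) (n - 1))\<close> while the threshold \<open>c n\<close> costs only \<open>exp n\<close>. The exponent \<open>A\<close> is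
arbitrary, which is what lets a union bound over exponentially many (in \<open>n\<close>) events succeed.\<close>

lemma centered_sum_squares_small_ball:
  fixes Y :: "nat \<Rightarrow> 'a \<Rightarrow> real"
  assumes ind: "indep_vars (\<lambda>_. borel) Y {..<n}"
    and D: "\<And>k. k < n \<Longrightarrow> distributed M lborel (Y k) std_normal_density"
    and n: "n \<ge> 2" and A: "A \<ge> 0"
    and c: "c = 2 / (exp (4 * (A + 1)) - 1)"
  shows "prob {\<omega> \<in> space M. \<not> c \<le> centered_sum_squares n (\<lambda>k. Y k \<omega>) / (real n - 1)} \<le> exp (- A * n)"
proof -
  have Y: "Y k \<in> borel_measurable M" if "k < n" for k
    using distributed_measurable[OF D[OF that]] by simp
  define C where "C \<omega> = centered_sum_squares n (\<lambda>k. Y k \<omega>)" for \<omega>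
  have meas[measurable]: "C \<in> borel_measurable M"
    unfolding C_def[abs_def] centered_sum_squares_def
    by (intro borel_measurable_sum borel_measurable_power borel_measurable_diff
        borel_measurable_divide borel_measurable_const Y; simp)+
  define l where "l = (exp (4 * (A + 1)) - 1) / 2"
  have e1: "exp (4 * (A + 1)) > 1"
    using A by simp
  have l: "l > 0" "1 + 2 * l = exp (4 * (A + 1))" "l * c = 1" "c > 0"
    using e1 by (simp_all add: l_def c field_simps)
  have "{\<omega> \<in> space M. \<not> c \<le> C \<omega> / (real n - 1)} \<subseteq> {\<omega> \<in> space M. - real n \<le> - l * C \<omega>}"
  proof safe
    fix \<omega> assume "\<not> c \<le> C \<omega> / (real n - 1)"
    then have "C \<omega> < c * (real n - 1)"
      using n by (simp add: not_le pos_divide_less_eq)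
    then have "l * C \<omega> < l * (c * (real n - 1))"
      using l by simp
    also have "\<dots> = real n - 1"
      using l by (simp add: mult.assoc[symmetric])
    finally show "- real n \<le> - l * C \<omega>" by simp
  qed
  then have "prob {\<omega> \<in> space M. \<not> c \<le> C \<omega> / (real n - 1)} \<le> prob {\<omega> \<in> space M. - real n \<le> - l * C \<omega>}"
    by (intro finite_measure_mono) auto
  also have "\<dots> \<le> exp (- (- real n)) * (1 + 2 * l) powr (- (real n - 1) / 2)"
    by (rule exponential_markov) (use l(1) n centered_sum_squares_mgf[OF ind D, of l, folded C_def] in auto)
  also have "\<dots> = exp (real n - 2 * (A + 1) * (real n - 1))"
    unfolding l(2) by (simp add: powr_def mult_exp_exp field_simps)
  also have "\<dots> \<le> exp (- A * n)"
  proof -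
    have "(A + 1) * real n \<le> (A + 1) * (2 * (real n - 1))"
      using n A by (intro mult_left_mono) auto
    then show ?thesis by (simp add: algebra_simps)
  qed
  finally show ?thesis by (simp add: C_def)
qed

end

section \<open>Quadratic forms of the sample covariance matrix\<close>

text \<open>The centre \<open>m\<close> is arbitrary because a centred sum of squares is invariant under translation; it will be
the unknown mean.\<close>

lemma bform_sample_cov:
  "bform p (sample_cov p n x) a a =
     centered_sum_squares n (\<lambda>k. \<Sum>i<p. a i * (x k i - m i)) / (real n - 1)"
proof (cases "n = 0")
  case True
  then show ?thesis
    by (simp add: bform_def sample_cov_def sample_mean_def centered_sum_squares_def)
next
  case False
  define y where "y k = (\<Sum>i<p. a i * (x k i - m i))" for k
  define z where "z k = (\<Sum>i<p. a i * (x k i - sample_mean n x i))" for k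
  define \<mu> where "\<mu> = (\<Sum>k<n. y k) / real n"
  have z: "z k = y k - \<mu>" for k
  proof -
    have "\<mu> = (\<Sum>i<p. a i * (sample_mean n x i - m i))"
    proof -
      have "(\<Sum>k<n. y k) = (\<Sum>i<p. a i * (\<Sum>k<n. x k i - m i))"
        unfolding y_def sum_distrib_left by (rule sum.swap)
      also have "\<dots> = (\<Sum>i<p. real n * (a i * (sample_mean n x i - m i)))"
        using False by (intro sum.cong) (auto simp: sample_mean_def sum_subtractf field_simps)
      also have "\<dots> = real n * (\<Sum>i<p. a i * (sample_mean n x i - m i))"
        by (simp add: sum_distrib_left)
      finally show ?thesis using False by (simp add: \<mu>_def)
    qed
    then show ?thesis
      by (simp add: z_def y_def sum_subtractf[symmetric] algebra_simps)
  qed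
  have "bform p (sample_cov p n x) a a =
      (\<Sum>i<p. \<Sum>j<p. \<Sum>k<n. a i * (x k i - sample_mean n x i) * (a j * (x k j - sample_mean n x j))) / (real n - 1)"
    by (simp add: bform_def sample_cov_def sum_divide_distrib sum_distrib_left sum_distrib_right ac_simps)
  also have "(\<Sum>i<p. \<Sum>j<p. \<Sum>k<n. a i * (x k i - sample_mean n x i) * (a j * (x k j - sample_mean n x j))) =
      (\<Sum>i<p. \<Sum>k<n. \<Sum>j<p. a i * (x k i - sample_mean n x i) * (a j * (x k j - sample_mean n x j)))"
    by (intro sum.cong refl sum.swap)
  also have "\<dots> = (\<Sum>k<n. \<Sum>i<p. \<Sum>j<p. a i * (x k i - sample_mean n x i) * (a j * (x k j - sample_mean n x j)))"
    by (rule sum.swap)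
  also have "\<dots> = (\<Sum>k<n. (z k)\<^sup>2)"
    by (simp add: z_def power2_eq_square sum_product)
  also have "\<dots> = (\<Sum>k<n. (y k)\<^sup>2 - 2 * \<mu> * y k + \<mu>\<^sup>2)"
    by (simp add: z power2_diff algebra_simps)
  also have "\<dots> = (\<Sum>k<n. (y k)\<^sup>2) - 2 * \<mu> * (\<Sum>k<n. y k) + real n * \<mu>\<^sup>2"
    by (simp add: sum.distrib sum_subtractf sum_distrib_left)
  also have "\<dots> = centered_sum_squares n y"
    using False by (simp add: centered_sum_squares_def \<mu>_def power2_eq_square field_simps)
  finally show ?thesis by (simp add: y_def[abs_def])
qed

lemma bform_scale: "bform p A (\<lambda>i. c * u i) (\<lambda>i. d * v i) = c * d * bform p A u v"
  unfolding bform_def sum_distrib_left by (intro sum.cong refl) (simp add: ac_simps)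

lemma bform_pos:
  assumes spd: "sym_pos_def p A" and a: "i < p" "a i \<noteq> 0"
  shows "bform p A a a > 0"
proof -
  have "vec p a \<noteq> 0\<^sub>v p"
    using a by (metis index_vec index_zero_vec(1))
  moreover have "A \<in> carrier_mat p p"
    using spd by (simp add: sym_pos_def_def)
  ultimately show ?thesis
    using spd unfolding sym_pos_def_def by (simp add: bform_scalar_prod)
qed

lemma bform_zero_left: "(\<And>i. i < p \<Longrightarrow> u i = 0) \<Longrightarrow> bform p A u v = 0"
  by (simp add: bform_def)

locale gaussian_sample = prob_space M for M :: "'a measure" +
  fixes n p :: nat and \<mu> :: "real vec" and \<Sigma> :: "real mat" and X :: "nat \<Rightarrow> 'a \<Rightarrow> nat \<Rightarrow> real"
  assumes mean: "\<mu> \<in> carrier_vec p"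
    and spd: "sym_pos_def p \<Sigma>"
    and indep: "indep_vars (\<lambda>_. Pi\<^sub>M {..<p} (\<lambda>_. lborel)) X {..<n}"
    and normal: "\<And>k. k < n \<Longrightarrow> normal_vec M p \<mu> \<Sigma> (X k)"
begin

definition S :: "'a \<Rightarrow> real mat" where
  "S \<omega> = sample_cov p n (\<lambda>k. X k \<omega>)"

lemma X_measurable:
  assumes "k < n" "i < p"
  shows "(\<lambda>\<omega>. X k \<omega> i) \<in> borel_measurable M"
proof -
  have "X k \<in> measurable M (Pi\<^sub>M {..<p} (\<lambda>_. lborel :: real measure))"
    using normal[OF assms(1)] unfolding normal_vec_def by (rule distributed_measurable)
  from measurable_compose[OF this measurable_component_singleton[of i]] show ?thesis
    using assms by simp
qed

lemma S_entry_measurable: "(\<lambda>\<omega>. S \<omega> $$ (i, j)) \<in> borel_measurable M" if "i < p" "j < p"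
proof -
  have "(\<lambda>\<omega>. (\<Sum>k<n. (X k \<omega> i - (\<Sum>k<n. X k \<omega> i) / real n) * (X k \<omega> j - (\<Sum>k<n. X k \<omega> j) / real n)) / (real n - 1))
      \<in> borel_measurable M"
    using that by (intro borel_measurable_sum borel_measurable_times borel_measurable_diff
        borel_measurable_divide borel_measurable_const X_measurable) auto
  then show ?thesis
    using that by (simp add: S_def sample_cov_def sample_mean_def)
qed

lemma bform_S_measurable: "(\<lambda>\<omega>. bform p (S \<omega>) u v) \<in> borel_measurable M"
proof -
  have "(\<lambda>\<omega>. u i * S \<omega> $$ (i, j) * v j) \<in> borel_measurable M" if "i < p" "j < p" for i j
    by (intro borel_measurable_times borel_measurable_const S_entry_measurable that)
  then show ?thesis
    unfolding bform_def by (intro borel_measurable_sum) (simp only: lessThan_iff)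
qed

text \<open>Dividing \<open>a\<close> by the standard deviation of \<open>a \<bullet> X\<close> makes the \<open>n\<close> observations of this functional i.i.d. standard
normal, so their sample variance is a normalized chi-square variable.\<close>

lemma standardized_quadratic_form:
  assumes "i < p" "a i \<noteq> 0"
  obtains Y :: "nat \<Rightarrow> 'a \<Rightarrow> real" where
    "indep_vars (\<lambda>_. borel) Y {..<n}"
    "\<And>k. k < n \<Longrightarrow> distributed M lborel (Y k) std_normal_density"
    "\<And>\<omega>. bform p (S \<omega>) a a =
      bform p \<Sigma> a a * (centered_sum_squares n (\<lambda>k. Y k \<omega>) / (real n - 1))"
proof -
  define v where "v = sqrt (bform p \<Sigma> a a)"
  have pos: "bform p \<Sigma> a a > 0"
    using bform_pos[of p \<Sigma> i a] spd assms by simp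
  then have v: "v > 0" "v * v = bform p \<Sigma> a a"
    unfolding v_def by simp_all
  define a' where "a' i = 1 / v * a i" for i
  have unit: "bform p \<Sigma> a' a' = 1"
    using v pos unfolding a'_def bform_scale by simp
  define Y where "Y k \<omega> = (\<Sum>i<p. a' i * (X k \<omega> i - \<mu> $ i))" for k \<omega>
  show ?thesis
  proof
    have "(\<lambda>y. \<Sum>i<p. a' i * (y i - \<mu> $ i)) \<in> borel_measurable (Pi\<^sub>M {..<p} (\<lambda>_. lborel))"
      by measurable
    then show "indep_vars (\<lambda>_. borel) Y {..<n}"
      unfolding Y_def[abs_def]
      by (intro indep_vars_compose2[OF indep, of "\<lambda>_ y. \<Sum>i<p. a' i * (y i - \<mu> $ i)"])
    show "distributed M lborel (Y k) std_normal_density" if "k < n" for k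
      unfolding Y_def[abs_def]
      by (rule normal_vec_linear_distributed[OF _ spd mean normal[OF that] unit]) unfold_locales
    fix \<omega>
    have "bform p (S \<omega>) a' a' = centered_sum_squares n (\<lambda>k. Y k \<omega>) / (real n - 1)"
      unfolding S_def Y_def by (rule bform_sample_cov)
    then show "bform p (S \<omega>) a a =
      bform p \<Sigma> a a * (centered_sum_squares n (\<lambda>k. Y k \<omega>) / (real n - 1))"
      using v unfolding a'_def bform_scale v(2)[symmetric] by (simp add: field_simps)
  qed
qed

text \<open>The error bound is relative to the variance \<open>a \<bullet> \<Sigma> a\<close>, so that it makes sense for every \<open>a\<close>,
including zero.\<close>

lemma quadratic_form_deviation:
  assumes n: "n \<ge> 2" and x: "x \<ge> 1" and b: "b > 0" "b * sqrt (x / n) \<le> 1 / 4"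
    and K: "K = 2 / b * (A + 4 * b\<^sup>2 + 1)" and A: "A \<ge> 0"
  shows "prob {\<omega> \<in> space M. \<not> \<bar>bform p (S \<omega>) a a - bform p \<Sigma> a a\<bar> \<le> K * sqrt (x / n) * bform p \<Sigma> a a}
    \<le> 2 * exp (- A * x)"
proof (cases "\<exists>i<p. a i \<noteq> 0")
  case True
  then obtain i where i: "i < p" "a i \<noteq> 0" by blast
  obtain Y :: "nat \<Rightarrow> 'a \<Rightarrow> real" where Y: "indep_vars (\<lambda>_. borel) Y {..<n}"
    "\<And>k. k < n \<Longrightarrow> distributed M lborel (Y k) std_normal_density"
    "\<And>\<omega>. bform p (S \<omega>) a a =
      bform p \<Sigma> a a * (centered_sum_squares n (\<lambda>k. Y k \<omega>) / (real n - 1))"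
    using standardized_quadratic_form[of i a, OF i] by metis
  have pos: "bform p \<Sigma> a a > 0" using bform_pos[of p \<Sigma> i a] spd i by simp
  have "\<bar>bform p \<Sigma> a a * q - bform p \<Sigma> a a\<bar> \<le> t * bform p \<Sigma> a a \<longleftrightarrow> \<bar>q - 1\<bar> \<le> t" for q t
  proof -
    have "\<bar>bform p \<Sigma> a a * q - bform p \<Sigma> a a\<bar> = \<bar>bform p \<Sigma> a a * (q - 1)\<bar>"
      by (simp add: algebra_simps)
    then show ?thesis using pos by (simp add: abs_mult mult.commute)
  qed
  then show ?thesis
    using centered_sum_squares_deviation[OF Y(1,2) n x b K A] by (simp only: Y(3))
next
  case False
  then have "bform p B a a = 0" for B by (intro bform_zero_left) auto
  then show ?thesis by simp
qed

lemma quadratic_form_small_ball: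
  assumes n: "n \<ge> 2" and A: "A \<ge> 0" and c: "c = 2 / (exp (4 * (A + 1)) - 1)"
  shows "prob {\<omega> \<in> space M. \<not> c * bform p \<Sigma> a a \<le> bform p (S \<omega>) a a} \<le> exp (- A * n)"
proof (cases "\<exists>i<p. a i \<noteq> 0")
  case True
  then obtain i where i: "i < p" "a i \<noteq> 0" by blast
  obtain Y :: "nat \<Rightarrow> 'a \<Rightarrow> real" where Y: "indep_vars (\<lambda>_. borel) Y {..<n}"
    "\<And>k. k < n \<Longrightarrow> distributed M lborel (Y k) std_normal_density"
    "\<And>\<omega>. bform p (S \<omega>) a a =
      bform p \<Sigma> a a * (centered_sum_squares n (\<lambda>k. Y k \<omega>) / (real n - 1))"
    using standardized_quadratic_form[of i a, OF i] by metis
  have pos: "bform p \<Sigma> a a > 0" using bform_pos[of p \<Sigma> i a] spd i by simp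
  have "c * bform p \<Sigma> a a \<le> bform p \<Sigma> a a * q \<longleftrightarrow> c \<le> q" for q
    using pos by (simp add: mult.commute)
  then show ?thesis
    using centered_sum_squares_small_ball[OF Y(1,2) n A c] by (simp only: Y(3))
next
  case False
  then have "bform p B a a = 0" for B by (intro bform_zero_left) auto
  then show ?thesis by simp
qed

end

section \<open>Quadratic forms and the spectrum\<close>

definition sqnorm :: "nat \<Rightarrow> (nat \<Rightarrow> real) \<Rightarrow> real" where
  "sqnorm p v = (\<Sum>i<p. (v i)\<^sup>2)"

lemma sqnorm_nonneg: "0 \<le> sqnorm p v"
  by (simp add: sqnorm_def sum_nonneg)

lemma sqnorm_eq_0: "sqnorm p v = 0 \<Longrightarrow> i < p \<Longrightarrow> v i = 0"
  by (simp add: sqnorm_def sum_nonneg_eq_0_iff)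

lemma sqnorm_scale: "sqnorm p (\<lambda>i. c * v i) = c\<^sup>2 * sqnorm p v"
  by (simp add: sqnorm_def sum_distrib_left power_mult_distrib)

lemma sqnorm_parallelogram:
  "sqnorm p (\<lambda>i. u i + v i) + sqnorm p (\<lambda>i. u i - v i) = 2 * sqnorm p u + 2 * sqnorm p v"
  unfolding sqnorm_def sum_distrib_left sum.distrib[symmetric]
  by (intro sum.cong refl) (simp add: power2_eq_square algebra_simps)

lemma sqnorm_component_le: "i < p \<Longrightarrow> (v i)\<^sup>2 \<le> sqnorm p v"
  unfolding sqnorm_def by (intro member_le_sum) auto

lemma bform_add_left: "bform p A (\<lambda>i. u i + u' i) v = bform p A u v + bform p A u' v"
  by (simp add: bform_def sum.distrib[symmetric] algebra_simps)

lemma bform_diff_left: "bform p A (\<lambda>i. u i - u' i) v = bform p A u v - bform p A u' v"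
  by (simp add: bform_def sum_subtractf[symmetric] algebra_simps)

lemma bform_add_right: "bform p A u (\<lambda>i. v i + v' i) = bform p A u v + bform p A u v'"
  by (simp add: bform_def sum.distrib[symmetric] algebra_simps)

lemma bform_diff_right: "bform p A u (\<lambda>i. v i - v' i) = bform p A u v - bform p A u v'"
  by (simp add: bform_def sum_subtractf[symmetric] algebra_simps)

lemma bform_minus_mat:
  "B \<in> carrier_mat p p \<Longrightarrow> bform p (A - B) u v = bform p A u v - bform p B u v"
  by (simp add: bform_def sum_subtractf[symmetric] algebra_simps)

definition sym_entries :: "nat \<Rightarrow> real mat \<Rightarrow> bool" where
  "sym_entries p A \<longleftrightarrow> (\<forall>i<p. \<forall>j<p. A $$ (i, j) = A $$ (j, i))"

lemma bform_sym:
  assumes "sym_entries p A"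
  shows "bform p A u v = bform p A v u"
  unfolding bform_def
  by (subst sum.swap) (use assms in \<open>auto simp: sym_entries_def intro!: sum.cong\<close>)

lemma sym_pos_def_sym_entries: "sym_pos_def p A \<Longrightarrow> sym_entries p A"
  unfolding sym_pos_def_def sym_entries_def by (metis carrier_matD index_transpose_mat(1))

lemma bform_parallelogram:
  assumes "sym_entries p A"
  shows "bform p A (\<lambda>i. u i + v i) (\<lambda>i. u i + v i) + bform p A (\<lambda>i. u i - v i) (\<lambda>i. u i - v i) =
    2 * bform p A u u + 2 * bform p A v v"
  by (simp add: bform_add_left bform_add_right bform_diff_left bform_diff_right bform_sym[OF assms, of v u])

lemma bform_polarization:
  assumes "sym_entries p A"
  shows "4 * bform p A u v =
    bform p A (\<lambda>i. u i + v i) (\<lambda>i. u i + v i) - bform p A (\<lambda>i. u i - v i) (\<lambda>i. u i - v i)"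
  by (simp add: bform_add_left bform_add_right bform_diff_left bform_diff_right bform_sym[OF assms, of v u])

lemma bform_bounded:
  assumes "sqnorm p u \<le> 1" "sqnorm p v \<le> 1"
  shows "\<bar>bform p A u v\<bar> \<le> (\<Sum>i<p. \<Sum>j<p. \<bar>A $$ (i, j)\<bar>)"
proof -
  have c: "\<bar>w i\<bar> \<le> 1" if "sqnorm p w \<le> 1" "i < p" for w i
  proof -
    have "(w i)\<^sup>2 \<le> 1"
      using sqnorm_component_le[OF that(2), of w] that(1) by linarith
    then show ?thesis by (simp add: abs_square_le_1)
  qed
  have "\<bar>bform p A u v\<bar> \<le> (\<Sum>i<p. \<Sum>j<p. \<bar>u i * A $$ (i, j) * v j\<bar>)"
    unfolding bform_def by (intro order.trans[OF sum_abs] sum_mono sum_abs)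
  also have "\<dots> \<le> (\<Sum>i<p. \<Sum>j<p. \<bar>A $$ (i, j)\<bar>)"
  proof (intro sum_mono)
    fix i j assume "i \<in> {..<p}" "j \<in> {..<p}"
    then have "\<bar>u i\<bar> * \<bar>A $$ (i, j)\<bar> * \<bar>v j\<bar> \<le> 1 * \<bar>A $$ (i, j)\<bar> * 1"
      using assms by (intro mult_mono c) auto
    then show "\<bar>u i * A $$ (i, j) * v j\<bar> \<le> \<bar>A $$ (i, j)\<bar>"
      by (simp add: abs_mult)
  qed
  finally show ?thesis .
qed

lemma bform_one_mat: "bform p (c \<cdot>\<^sub>m 1\<^sub>m p) u v = c * (\<Sum>i<p. u i * v i)"
proof -
  have "(\<Sum>j<p. u i * (c \<cdot>\<^sub>m 1\<^sub>m p) $$ (i, j) * v j) = c * (u i * v i)" if "i < p" for i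
  proof -
    have "(\<Sum>j<p. u i * (c \<cdot>\<^sub>m 1\<^sub>m p) $$ (i, j) * v j) = (\<Sum>j<p. if j = i then c * (u i * v i) else 0)"
      using that by (intro sum.cong) auto
    then show ?thesis using that by simp
  qed
  then show ?thesis by (simp add: bform_def sum_distrib_left)
qed

lemma quadratic_form_scale_unit:
  assumes "sqnorm p v > 0"
  obtains u where "sqnorm p u = 1" "\<And>i. v i = 0 \<Longrightarrow> u i = 0"
    "\<And>A. bform p A v v = sqnorm p v * bform p A u u"
proof
  let ?c = "1 / sqrt (sqnorm p v)"
  show "sqnorm p (\<lambda>i. ?c * v i) = 1"
    using assms by (simp only: sqnorm_scale) (simp add: power_divide)
  show "?c * v i = 0" if "v i = 0" for i using that by simp
  show "bform p A v v = sqnorm p v * bform p A (\<lambda>i. ?c * v i) (\<lambda>i. ?c * v i)" for A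
    using assms by (simp only: bform_scale) (simp add: field_simps)
qed

lemma bform_zero_of_sqnorm: "sqnorm p u = 0 \<Longrightarrow> bform p A u v = 0"
  by (intro bform_zero_left) (rule sqnorm_eq_0)

text \<open>Let \<open>m\<close> be the infimum of the Rayleigh quotient, so that \<open>P = A - m I\<close> is positive semidefinite. If \<open>P\<close> were
invertible, its form would be at least \<open>1 / L\<close> on unit vectors \<open>v\<close>, where \<open>L\<close> bounds the
form of the inverse: expand the nonnegative form of \<open>P\<close> at \<open>v - w / L\<close> with \<open>P w = v\<close>. This
contradicts the choice of \<open>m\<close>. Hence \<open>P\<close> is singular and \<open>m\<close> is an eigenvalue; no
compactness of the sphere and no diagonalization is involved.\<close>

lemma rayleigh_infimum_eigenvalue:
  assumes A: "A \<in> carrier_mat p p" and sym: "sym_entries p A" and p: "p > 0"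
  obtains m where "eigenvalue A m" "\<And>v. m * sqnorm p v \<le> bform p A v v"
proof -
  define R where "R = {bform p A v v | v. sqnorm p v = 1}"
  define m where "m = Inf R"
  have bdd: "bdd_below R"
  proof (rule bdd_belowI)
    fix y assume "y \<in> R"
    then obtain v where "y = bform p A v v" "sqnorm p v = 1" by (auto simp: R_def)
    then show "- (\<Sum>i<p. \<Sum>j<p. \<bar>A $$ (i, j)\<bar>) \<le> y"
      using bform_bounded[of p v v A] by (simp add: abs_le_iff)
  qed
  have ne: "R \<noteq> {}"
  proof -
    have "sqnorm p (\<lambda>i. if i = 0 then 1 else 0) = (\<Sum>i<p. if i = 0 then 1 else 0)"
      unfolding sqnorm_def by (intro sum.cong) auto
    also have "\<dots> = 1" using p by simp
    finally show ?thesis by (auto simp: R_def)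
  qed
  have low: "m * sqnorm p v \<le> bform p A v v" for v
  proof (cases "sqnorm p v = 0")
    case True
    then show ?thesis by (simp add: bform_zero_of_sqnorm)
  next
    case False
    then have "sqnorm p v > 0" using sqnorm_nonneg[of p v] by simp
    then obtain u where u: "sqnorm p u = 1" "bform p A v v = sqnorm p v * bform p A u u"
      by (metis quadratic_form_scale_unit)
    have "m \<le> bform p A u u"
      unfolding m_def using u bdd by (intro cInf_lower) (auto simp: R_def)
    from mult_left_mono[OF this sqnorm_nonneg[of p v]] show ?thesis
      using u(2) by (simp add: mult.commute)
  qed
  define P where "P = A - m \<cdot>\<^sub>m 1\<^sub>m p"
  have P: "P \<in> carrier_mat p p"
    unfolding P_def by (rule minus_carrier_mat) simp
  have Pform: "bform p P u v = bform p A u v - m * (\<Sum>i<p. u i * v i)" for u v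
    unfolding P_def by (subst bform_minus_mat) (auto simp: bform_one_mat)
  have Psym: "sym_entries p P"
    using sym A unfolding sym_entries_def P_def by auto
  have "det P = 0"
  proof (rule ccontr)
    assume "det P \<noteq> 0"
    note inv = inv_mat_correct[OF P this]
    define L where "L = (\<Sum>i<p. \<Sum>j<p. \<bar>inv_mat P $$ (i, j)\<bar>) + 1"
    have L: "L > 0"
      unfolding L_def by (intro add_nonneg_pos sum_nonneg) auto
    have "m + 1 / L \<le> y" if y: "y \<in> R" for y
    proof -
      obtain v where v: "y = bform p A v v" "sqnorm p v = 1" using y by (auto simp: R_def)
      define w where "w i = (inv_mat P *\<^sub>v vec p v) $ i" for i
      have vw: "vec p w = inv_mat P *\<^sub>v vec p v"
        using inv by (intro eq_vecI) (auto simp: w_def)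
      have Pw: "P *\<^sub>v vec p w = vec p v"
        unfolding vw using inv P by (metis assoc_mult_mat_vec one_mult_mat_vec vec_carrier)
      have "bform p P v w = vec p v \<bullet> vec p v"
        by (simp add: bform_scalar_prod[OF P] Pw)
      also have "\<dots> = 1"
        using v(2) by (simp add: scalar_prod_def sqnorm_def lessThan_atLeast0 power2_eq_square)
      finally have 1: "bform p P v w = 1" .
      have "bform p P w w = vec p w \<bullet> vec p v"
        by (simp add: bform_scalar_prod[OF P] Pw)
      also have "\<dots> = vec p v \<bullet> vec p w" by (rule comm_scalar_prod[of _ p]) auto
      also have "\<dots> = bform p (inv_mat P) v v"
        using inv by (simp add: bform_scalar_prod vw)
      also have "\<dots> \<le> L"
        using bform_bounded[of p v v "inv_mat P"] v(2) by (simp add: L_def)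
      finally have 2: "bform p P w w \<le> L" .
      have "0 \<le> bform p P (\<lambda>i. v i - 1 / L * w i) (\<lambda>i. v i - 1 / L * w i)"
        using low[of "\<lambda>i. v i - 1 / L * w i"] unfolding Pform sqnorm_def power2_eq_square by simp
      also have "\<dots> = bform p P v v - 2 * (1 / L) * bform p P v w + (1 / L)\<^sup>2 * bform p P w w"
        using bform_scale[of p P 1 v "1 / L" w] bform_scale[of p P "1 / L" w 1 v]
          bform_scale[of p P "1 / L" w "1 / L" w]
        by (simp add: bform_diff_left bform_diff_right bform_sym[OF Psym, of w v] power2_eq_square)
      also have "\<dots> \<le> bform p P v v - 2 * (1 / L) + (1 / L)\<^sup>2 * L"
        using 2 by (simp add: 1 mult_left_mono divide_right_mono)
      also have "\<dots> = bform p A v v - m - 1 / L"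
        using v(2) L unfolding Pform sqnorm_def by (simp add: power2_eq_square)
      finally show ?thesis using v by simp
    qed
    then have "m + 1 / L \<le> m"
      unfolding m_def[symmetric] using ne by (subst (2) m_def) (intro cInf_greatest)
    then show False using L by simp
  qed
  then obtain v where v: "v \<in> carrier_vec p" "v \<noteq> 0\<^sub>v p" "P *\<^sub>v v = 0\<^sub>v p"
    using det_0_iff_vec_prod_zero[OF P] by blast
  have "A *\<^sub>v v = m \<cdot>\<^sub>v v"
  proof (rule eq_vecI)
    fix i assume "i < dim_vec (m \<cdot>\<^sub>v v)"
    then have i: "i < p" using v by simp
    have "P *\<^sub>v v = A *\<^sub>v v - (m \<cdot>\<^sub>m 1\<^sub>m p) *\<^sub>v v"
      unfolding P_def using A v by (intro minus_mult_distrib_mat_vec) auto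
    also have "(m \<cdot>\<^sub>m 1\<^sub>m p) *\<^sub>v v = m \<cdot>\<^sub>v v"
      using v by auto
    finally have "(A *\<^sub>v v - m \<cdot>\<^sub>v v) $ i = 0" using v(3) i by (metis index_zero_vec(1))
    then show "(A *\<^sub>v v) $ i = (m \<cdot>\<^sub>v v) $ i" using i v A by simp
  qed (use A v in auto)
  then have "eigenvalue A m"
    unfolding eigenvalue_def eigenvector_def using v A by auto
  then show ?thesis using low that by blast
qed

lemma eigenvalue_uminus:
  fixes A :: "real mat"
  assumes "A \<in> carrier_mat p p" "eigenvalue (- A) k"
  shows "eigenvalue A (- k)"
proof -
  obtain v where v: "v \<in> carrier_vec p" "v \<noteq> 0\<^sub>v p" "(- A) *\<^sub>v v = k \<cdot>\<^sub>v v"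
    using assms unfolding eigenvalue_def eigenvector_def by auto
  have "A *\<^sub>v v = (- k) \<cdot>\<^sub>v v"
  proof (rule eq_vecI)
    fix i assume "i < dim_vec ((- k) \<cdot>\<^sub>v v)"
    then have i: "i < p" using v by simp
    have "- (A *\<^sub>v v) = k \<cdot>\<^sub>v v"
      using v assms by simp
    then have "(- (A *\<^sub>v v)) $ i = (k \<cdot>\<^sub>v v) $ i"
      by (simp only:)
    then show "(A *\<^sub>v v) $ i = ((- k) \<cdot>\<^sub>v v) $ i"
      using v i assms by simp
  qed (use assms v in auto)
  then show ?thesis
    using v assms unfolding eigenvalue_def eigenvector_def by auto
qed

text \<open>The upper bound is the lower bound for \<open>- A\<close>.\<close>

lemma quadratic_form_eigenvalue_bounds:
  assumes A: "A \<in> carrier_mat p p" and sym: "sym_entries p A" and p: "p > 0"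
    and ev: "\<And>k. eigenvalue A k \<Longrightarrow> c \<le> k \<and> k \<le> C"
  shows "c * sqnorm p v \<le> bform p A v v" "bform p A v v \<le> C * sqnorm p v"
proof -
  obtain m where m: "eigenvalue A m" "m * sqnorm p v \<le> bform p A v v"
    using rayleigh_infimum_eigenvalue[OF A sym p] by metis
  have "c * sqnorm p v \<le> m * sqnorm p v"
    using ev[OF m(1)] sqnorm_nonneg by (intro mult_right_mono) auto
  then show "c * sqnorm p v \<le> bform p A v v" using m(2) by linarith
  have "- A \<in> carrier_mat p p" "sym_entries p (- A)"
    using A sym by (auto simp: sym_entries_def)
  then obtain m where m: "eigenvalue (- A) m" "m * sqnorm p v \<le> bform p (- A) v v"
    using rayleigh_infimum_eigenvalue[OF _ _ p, of "- A"] by metis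
  have "bform p (- A) v v = - bform p A v v"
    using A by (simp add: bform_def sum_negf[symmetric])
  moreover have "- m * sqnorm p v \<le> C * sqnorm p v"
    using ev[OF eigenvalue_uminus[OF A m(1)]] sqnorm_nonneg by (intro mult_right_mono) auto
  ultimately show "bform p A v v \<le> C * sqnorm p v" using m(2) by linarith
qed

section \<open>Lattice nets for coordinate subspaces\<close>

lemma geometric_sum_int_le_3: "(\<Sum>k\<in>{-int N..int N}. (1/2::real) ^ nat \<bar>k\<bar>) \<le> 3"
proof -
  have "(\<Sum>k\<in>{-int N..int N}. (1/2::real) ^ nat \<bar>k\<bar>) = 3 - 2 * (1/2) ^ N"
  proof (induction N)
    case (Suc N)
    have "{-int (Suc N)..int (Suc N)} = insert (int (Suc N)) (insert (- int (Suc N)) {-int N..int N})"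
      by auto
    moreover have "nat \<bar>- int (Suc N)\<bar> = Suc N" "nat \<bar>int (Suc N)\<bar> = Suc N" by simp_all
    ultimately show ?case
      using Suc by (subst \<open>{-int (Suc N)..int (Suc N)} = _\<close>) (simp del: of_nat_Suc)
  qed simp
  then show ?thesis by simp
qed

definition lattice_coeffs :: "nat set \<Rightarrow> nat \<Rightarrow> (nat \<Rightarrow> int) set" where
  "lattice_coeffs T N = {c \<in> T \<rightarrow>\<^sub>E {-int N..int N}. (\<Sum>i\<in>T. \<bar>c i\<bar>) \<le> int N}"

lemma finite_lattice_coeffs: "finite T \<Longrightarrow> finite (lattice_coeffs T N)"
  unfolding lattice_coeffs_def
  by (rule finite_subset[of _ "T \<rightarrow>\<^sub>E {-int N..int N}"]) (auto intro!: finite_PiE)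

text \<open>A coefficient vector of \<open>l\<^sub>1\<close>-norm at most \<open>N\<close> contributes at least one to the sum of \<open>2 ^ N * (1/2) ^ |c|\<close> over
all integer vectors of the box, where \<open>|c|\<close> is the \<open>l\<^sub>1\<close>-norm, and that sum factorizes over the coordinates.\<close>

lemma card_lattice_coeffs:
  assumes T: "finite T"
  shows "real (card (lattice_coeffs T N)) \<le> 2 ^ N * 3 ^ card T"
proof -
  let ?P = "T \<rightarrow>\<^sub>E {-int N..int N}"
  have "real (card (lattice_coeffs T N)) = (\<Sum>c\<in>lattice_coeffs T N. 1)"
    by simp
  also have "\<dots> \<le> (\<Sum>c\<in>lattice_coeffs T N. 2 ^ N * (\<Prod>i\<in>T. (1/2::real) ^ nat \<bar>c i\<bar>))"
  proof (rule sum_mono)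
    fix c assume c: "c \<in> lattice_coeffs T N"
    have "int (\<Sum>i\<in>T. nat \<bar>c i\<bar>) = (\<Sum>i\<in>T. \<bar>c i\<bar>)"
      by simp
    then have "(\<Sum>i\<in>T. nat \<bar>c i\<bar>) \<le> N"
      using c unfolding lattice_coeffs_def by (simp del: of_nat_sum)
    then have "(1/2::real) ^ N \<le> (1/2) ^ (\<Sum>i\<in>T. nat \<bar>c i\<bar>)"
      by (intro power_decreasing) auto
    also have "\<dots> = (\<Prod>i\<in>T. (1/2) ^ nat \<bar>c i\<bar>)"
      by (rule power_sum)
    finally have "2 ^ N * (1/2::real) ^ N \<le> 2 ^ N * (\<Prod>i\<in>T. (1/2) ^ nat \<bar>c i\<bar>)"
      by (intro mult_left_mono) auto
    then show "1 \<le> 2 ^ N * (\<Prod>i\<in>T. (1/2::real) ^ nat \<bar>c i\<bar>)"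
      by (simp add: power_mult_distrib[symmetric])
  qed
  also have "\<dots> \<le> (\<Sum>c\<in>?P. 2 ^ N * (\<Prod>i\<in>T. (1/2::real) ^ nat \<bar>c i\<bar>))"
    using T by (intro sum_mono2 finite_PiE) (auto simp: lattice_coeffs_def intro!: prod_nonneg mult_nonneg_nonneg)
  also have "\<dots> = 2 ^ N * (\<Prod>i\<in>T. \<Sum>k\<in>{-int N..int N}. (1/2::real) ^ nat \<bar>k\<bar>)"
    unfolding sum_distrib_left[symmetric] by (subst prod_sum_PiE[OF T]) auto
  also have "\<dots> \<le> 2 ^ N * (\<Prod>i\<in>T. 3)"
    by (intro mult_left_mono prod_mono conjI sum_nonneg geometric_sum_int_le_3) auto
  finally show ?thesis by simp
qed

text \<open>Lattice points of mesh \<open>1 / (r \<surd>|T|)\<close>, so that one step in every coordinate moves a point by \<open>1 / r\<close>. The unit ball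
has \<open>l\<^sub>1\<close>-norm at most \<open>\<surd>|T|\<close>, hence coefficients of \<open>l\<^sub>1\<close>-norm at most \<open>r |T|\<close> suffice.\<close>

definition lattice_net :: "nat set \<Rightarrow> nat \<Rightarrow> (nat \<Rightarrow> real) set" where
  "lattice_net T r =
     (\<lambda>c i. if i \<in> T then of_int (c i) / (real r * sqrt (card T)) else 0) ` lattice_coeffs T (r * card T)"

lemma finite_lattice_net: "finite T \<Longrightarrow> finite (lattice_net T r)"
  by (simp add: lattice_net_def finite_lattice_coeffs)

lemma card_lattice_net:
  assumes "finite T"
  shows "real (card (lattice_net T r)) \<le> (3 * 2 ^ r) ^ card T"
proof -
  have "card (lattice_net T r) \<le> card (lattice_coeffs T (r * card T))"
    unfolding lattice_net_def using assms by (intro card_image_le finite_lattice_coeffs)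
  also have "real \<dots> \<le> 2 ^ (r * card T) * 3 ^ card T"
    by (rule card_lattice_coeffs[OF assms])
  also have "\<dots> = (3 * 2 ^ r) ^ card T"
    by (simp add: power_mult power_mult_distrib)
  finally show ?thesis by simp
qed

definition supported :: "nat set \<Rightarrow> (nat \<Rightarrow> real) \<Rightarrow> bool" where
  "supported T v \<longleftrightarrow> (\<forall>i. i \<notin> T \<longrightarrow> v i = 0)"

lemma supported_scale: "supported T v \<Longrightarrow> supported T (\<lambda>i. c * v i)"
  and supported_add: "supported T u \<Longrightarrow> supported T v \<Longrightarrow> supported T (\<lambda>i. u i + v i)"
  and supported_diff: "supported T u \<Longrightarrow> supported T v \<Longrightarrow> supported T (\<lambda>i. u i - v i)"
  by (simp_all add: supported_def)

lemma supported_lattice_net: "z \<in> lattice_net T r \<Longrightarrow> supported T z"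
  by (auto simp: lattice_net_def supported_def)

lemma sqnorm_supported:
  assumes "T \<subseteq> {..<p}" "supported T v"
  shows "sqnorm p v = (\<Sum>i\<in>T. (v i)\<^sup>2)"
  unfolding sqnorm_def using assms by (intro sum.mono_neutral_right) (auto simp: supported_def)

text \<open>Every coordinate is rounded towards zero. Rounding in this direction keeps the approximating point in the
unit ball and its coefficients within the \<open>l\<^sub>1\<close>-bound of the net.\<close>

lemma lattice_net_approximates:
  assumes T: "T \<subseteq> {..<p}" "T \<noteq> {}" and r: "r > 0" and v: "supported T v" "sqnorm p v \<le> 1"
  obtains z where "z \<in> lattice_net T r" "sqnorm p z \<le> 1" "sqnorm p (\<lambda>i. v i - z i) \<le> 1 / (real r)\<^sup>2"
proof -
  have fin: "finite T" using T finite_subset by blast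
  define s where "s = card T"
  have s: "s > 0" using fin T by (simp add: s_def card_gt_0_iff)
  define h where "h = real r * sqrt s"
  have h: "h > 0" using r s by (simp add: h_def)
  define c where "c = (\<lambda>i. if i \<in> T then (if v i \<ge> 0 then \<lfloor>v i * h\<rfloor> else \<lceil>v i * h\<rceil>) else undefined)"
  define z where "z = (\<lambda>i. if i \<in> T then of_int (c i) / h else 0)"
  have c_abs: "real_of_int \<bar>c i\<bar> \<le> \<bar>v i\<bar> * h" if "i \<in> T" for i
  proof (cases "v i \<ge> 0")
    case True
    then have "0 \<le> \<lfloor>v i * h\<rfloor>" using h by simp
    then show ?thesis using True that by (simp add: c_def)
  next
    case False
    then have "v i * h \<le> 0" using h by (simp add: mult_nonpos_nonneg)
    then have "\<lceil>v i * h\<rceil> \<le> 0" by (simp add: ceiling_le_zero)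
    then have "real_of_int \<bar>c i\<bar> = - real_of_int \<lceil>v i * h\<rceil>"
      using False that by (simp add: c_def)
    also have "\<dots> \<le> - (v i * h)"
      using le_of_int_ceiling[of "v i * h"] by linarith
    also have "\<dots> = \<bar>v i\<bar> * h"
      using False by simp
    finally show ?thesis .
  qed
  have c_close: "\<bar>v i * h - of_int (c i)\<bar> \<le> 1" if "i \<in> T" for i
    using that by (auto simp: c_def) linarith+
  have sqv: "(\<Sum>i\<in>T. (v i)\<^sup>2) \<le> 1"
    using v sqnorm_supported[OF T(1) v(1)] by simp
  have l1: "(\<Sum>i\<in>T. \<bar>v i\<bar>) \<le> sqrt s"
  proof -
    have "(\<Sum>i\<in>T. \<bar>v i\<bar>)\<^sup>2 \<le> (\<Sum>i\<in>T. \<bar>v i\<bar>\<^sup>2) * real (card T)"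
      using Cauchy_Schwarz_ineq_sum[of "\<lambda>i. \<bar>v i\<bar>" "\<lambda>_. 1" T] by simp
    also have "\<dots> \<le> 1 * real s"
      using sqv by (intro mult_mono) (auto simp: s_def)
    finally show ?thesis
      by (intro real_le_rsqrt) simp
  qed
  have "real_of_int (\<Sum>i\<in>T. \<bar>c i\<bar>) \<le> (\<Sum>i\<in>T. \<bar>v i\<bar> * h)"
    unfolding of_int_sum by (intro sum_mono c_abs)
  also have "\<dots> = (\<Sum>i\<in>T. \<bar>v i\<bar>) * h"
    by (simp add: sum_distrib_right)
  also have "\<dots> \<le> sqrt s * h"
    using l1 h by (intro mult_right_mono) auto
  also have "\<dots> = real_of_int (int (r * s))"
    by (simp add: h_def)
  finally have csum: "(\<Sum>i\<in>T. \<bar>c i\<bar>) \<le> int (r * s)"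
    by (simp only: of_int_le_iff)
  have cbound: "c i \<in> {- int (r * s)..int (r * s)}" if "i \<in> T" for i
  proof -
    have "\<bar>c i\<bar> \<le> (\<Sum>i\<in>T. \<bar>c i\<bar>)"
      using that fin by (intro member_le_sum) auto
    then have "\<bar>c i\<bar> \<le> int (r * s)" using csum by linarith
    then show ?thesis by (auto simp: abs_le_iff)
  qed
  have "c \<in> lattice_coeffs T (r * s)"
    unfolding lattice_coeffs_def using csum cbound by (auto simp: c_def)
  then have 1: "z \<in> lattice_net T r"
    unfolding lattice_net_def z_def h_def s_def by blast
  have zv: "\<bar>z i\<bar> \<le> \<bar>v i\<bar>" if "i \<in> T" for i
  proof -
    have "\<bar>z i\<bar> = real_of_int \<bar>c i\<bar> / h" using that h by (simp add: z_def)
    also have "\<dots> \<le> \<bar>v i\<bar>" using c_abs[OF that] h by (simp add: pos_divide_le_eq)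
    finally show ?thesis .
  qed
  have "sqnorm p z = (\<Sum>i\<in>T. (z i)\<^sup>2)"
    by (rule sqnorm_supported[OF T(1) supported_lattice_net[OF 1]])
  also have "\<dots> \<le> (\<Sum>i\<in>T. (v i)\<^sup>2)"
    by (intro sum_mono) (use zv in \<open>simp add: abs_le_square_iff\<close>)
  finally have 2: "sqnorm p z \<le> 1" using sqv by simp
  have "sqnorm p (\<lambda>i. v i - z i) = (\<Sum>i\<in>T. (v i - z i)\<^sup>2)"
    by (intro sqnorm_supported T supported_diff v supported_lattice_net[OF 1])
  also have "\<dots> \<le> (\<Sum>i\<in>T. 1 / h\<^sup>2)"
  proof (rule sum_mono)
    fix i assume i: "i \<in> T"
    have "v i - z i = (v i * h - of_int (c i)) / h"
      using i h by (simp add: z_def field_simps)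
    then have "(v i - z i)\<^sup>2 = (v i * h - of_int (c i))\<^sup>2 / h\<^sup>2"
      by (simp add: power_divide)
    also have "\<dots> \<le> 1 / h\<^sup>2"
      using c_close[OF i] by (intro divide_right_mono) (auto simp: abs_square_le_1)
    finally show "(v i - z i)\<^sup>2 \<le> 1 / h\<^sup>2" .
  qed
  also have "\<dots> = 1 / (real r)\<^sup>2"
    using s by (simp add: h_def power_mult_distrib s_def[symmetric])
  finally have 3: "sqnorm p (\<lambda>i. v i - z i) \<le> 1 / (real r)\<^sup>2" .
  show ?thesis using that 1 2 3 .
qed

text \<open>Polarization of unit vectors: the parallelogram law turns the two quadratic bounds into \<open>4 M\<close>.\<close>

lemma bilinear_bound_of_quadratic_bound:
  assumes sym: "sym_entries p A" and u: "supported T u" and w: "supported T w"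
    and M: "\<And>v. supported T v \<Longrightarrow> \<bar>bform p A v v\<bar> \<le> M * sqnorm p v"
  shows "\<bar>bform p A u w\<bar> \<le> M * sqrt (sqnorm p u) * sqrt (sqnorm p w)"
proof (cases "sqnorm p u = 0 \<or> sqnorm p w = 0")
  case True
  then have "bform p A u w = 0"
    using bform_zero_of_sqnorm bform_sym[OF sym] by metis
  then show ?thesis using True by auto
next
  case False
  then have pos: "sqnorm p u > 0" "sqnorm p w > 0"
    using sqnorm_nonneg[of p u] sqnorm_nonneg[of p w] by linarith+
  define a where "a = sqrt (sqnorm p u)"
  define b where "b = sqrt (sqnorm p w)"
  have ab: "a > 0" "b > 0" "sqnorm p u = a\<^sup>2" "sqnorm p w = b\<^sup>2"
    using pos by (simp_all add: a_def b_def)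
  define u' where "u' i = 1 / a * u i" for i
  define w' where "w' i = 1 / b * w i" for i
  have unit: "sqnorm p u' = 1" "sqnorm p w' = 1"
    unfolding u'_def w'_def sqnorm_scale using ab by (simp_all add: power_divide)
  have supp: "supported T u'" "supported T w'"
    unfolding u'_def w'_def by (intro supported_scale u w)+
  have "4 * \<bar>bform p A u' w'\<bar> \<le>
      \<bar>bform p A (\<lambda>i. u' i + w' i) (\<lambda>i. u' i + w' i)\<bar> + \<bar>bform p A (\<lambda>i. u' i - w' i) (\<lambda>i. u' i - w' i)\<bar>"
    using bform_polarization[OF sym, of u' w'] by linarith
  also have "\<dots> \<le> M * sqnorm p (\<lambda>i. u' i + w' i) + M * sqnorm p (\<lambda>i. u' i - w' i)"
    by (intro add_mono M supported_add supported_diff supp)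
  also have "\<dots> = 4 * M"
    unfolding distrib_left[symmetric] sqnorm_parallelogram unit by simp
  finally have "\<bar>bform p A u' w'\<bar> \<le> M" by simp
  moreover have "bform p A u' w' = bform p A u w / (a * b)"
    unfolding u'_def w'_def bform_scale by simp
  ultimately have "\<bar>bform p A u w\<bar> / (a * b) \<le> M"
    using ab by (simp add: abs_mult)
  then show ?thesis
    using ab by (simp add: pos_divide_le_eq a_def[symmetric] b_def[symmetric] mult.assoc)
qed

text \<open>Let \<open>M\<close> be the supremum over the unit ball, and let \<open>z\<close> be a net point within \<open>1/4\<close> of \<open>v\<close>. The forms at
\<open>v\<close> and \<open>z\<close> differ by the bilinear form of \<open>v - z\<close> and \<open>v + z\<close>, that is by at most \<open>M (1/4) 2\<close>. Thus
\<open>M \<le> B + M / 2\<close>, and \<open>M\<close> is finite, so \<open>M \<le> 2 B\<close>.\<close>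

lemma net_controls_quadratic_form:
  assumes sym: "sym_entries p A" and T: "T \<subseteq> {..<p}" "T \<noteq> {}"
    and net: "\<And>z. z \<in> lattice_net T 4 \<Longrightarrow> sqnorm p z \<le> 1 \<Longrightarrow> \<bar>bform p A z z\<bar> \<le> B"
    and v: "supported T v"
  shows "\<bar>bform p A v v\<bar> \<le> 2 * B * sqnorm p v"
proof -
  define R where "R = {\<bar>bform p A v v\<bar> | v. supported T v \<and> sqnorm p v \<le> 1}"
  define M where "M = Sup R"
  have bdd: "bdd_above R"
    unfolding R_def by (rule bdd_aboveI) (use bform_bounded in blast)
  have zero: "supported T (\<lambda>_. 0)" "sqnorm p (\<lambda>_. 0) \<le> 1"
    by (simp_all add: supported_def sqnorm_def)
  have ne: "R \<noteq> {}" using zero unfolding R_def by blast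
  have le_M: "\<bar>bform p A v v\<bar> \<le> M" if "supported T v" "sqnorm p v \<le> 1" for v
    unfolding M_def using that bdd by (intro cSup_upper) (auto simp: R_def)
  have M0: "0 \<le> M"
    using le_M[OF zero] by linarith
  have M_quad: "\<bar>bform p A v v\<bar> \<le> M * sqnorm p v" if v: "supported T v" for v
  proof (cases "sqnorm p v = 0")
    case True
    then show ?thesis by (simp add: bform_zero_of_sqnorm)
  next
    case False
    then have "sqnorm p v > 0" using sqnorm_nonneg[of p v] by simp
    then obtain u where u: "sqnorm p u = 1" "\<And>i. v i = 0 \<Longrightarrow> u i = 0"
      "\<And>A. bform p A v v = sqnorm p v * bform p A u u"
      using quadratic_form_scale_unit by metis
    have "\<bar>bform p A u u\<bar> \<le> M"
      using u v by (intro le_M) (auto simp: supported_def)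
    from mult_left_mono[OF this sqnorm_nonneg[of p v]] show ?thesis
      unfolding u(3) by (simp add: abs_mult sqnorm_nonneg mult.commute)
  qed
  have "M \<le> B + M / 2"
    unfolding M_def
  proof (rule cSup_least[OF ne], fold M_def)
    fix y assume "y \<in> R"
    then obtain v where v: "y = \<bar>bform p A v v\<bar>" "supported T v" "sqnorm p v \<le> 1"
      by (auto simp: R_def)
    obtain z where z: "z \<in> lattice_net T 4" "sqnorm p z \<le> 1" "sqnorm p (\<lambda>i. v i - z i) \<le> 1 / 16"
      using lattice_net_approximates[OF T _ v(2,3), of 4] by auto
    note sz = supported_lattice_net[OF z(1)]
    have "sqnorm p (\<lambda>i. v i + z i) \<le> 4"
      using sqnorm_parallelogram[of p v z] sqnorm_nonneg[of p "\<lambda>i. v i - z i"] v z by linarith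
    then have sq: "sqrt (sqnorm p (\<lambda>i. v i + z i)) \<le> 2"
      by (intro real_le_lsqrt) auto
    have sq': "sqrt (sqnorm p (\<lambda>i. v i - z i)) \<le> 1 / 4"
      by (rule real_le_lsqrt) (use z(3) in \<open>auto simp: power2_eq_square\<close>)
    have "bform p A v v - bform p A z z = bform p A (\<lambda>i. v i - z i) (\<lambda>i. v i + z i)"
      by (simp add: bform_diff_left bform_add_right bform_sym[OF sym, of z v])
    also have "\<bar>\<dots>\<bar> \<le> M * sqrt (sqnorm p (\<lambda>i. v i - z i)) * sqrt (sqnorm p (\<lambda>i. v i + z i))"
      by (intro bilinear_bound_of_quadratic_bound[OF sym, of T] supported_add supported_diff v sz M_quad)
    also have "\<dots> \<le> M * (1 / 4) * 2"
      using M0 sq sq' by (intro mult_mono) (auto simp: sqnorm_nonneg)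
    finally show "y \<le> B + M / 2"
      using net[OF z(1,2)] v(1) by linarith
  qed
  then have "M \<le> 2 * B" by simp
  then show ?thesis
    using M_quad[OF v] mult_right_mono[OF _ sqnorm_nonneg[of p v], of M "2 * B"] by linarith
qed

text \<open>For a unit vector \<open>u\<close> and a net point \<open>z\<close> within \<open>1 / r\<close> of it, the parallelogram law gives
\<open>Q z \<le> 2 Q u + 2 Q (u - z)\<close>. The net controls \<open>Q z\<close> from below, and the upper bound \<open>C\<close> makes \<open>Q (u - z)\<close>
negligible once \<open>r\<^sup>2\<close> is large compared with \<open>C / c\<close>.\<close>

lemma net_lower_bound_quadratic_form:
  assumes sym: "sym_entries p A" and T: "T \<subseteq> {..<p}" "T \<noteq> {}"
    and psd: "\<And>v. 0 \<le> bform p A v v"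
    and upper: "\<And>v. supported T v \<Longrightarrow> bform p A v v \<le> C * sqnorm p v"
    and net: "\<And>z. z \<in> lattice_net T r \<Longrightarrow> c * sqnorm p z \<le> bform p A z z"
    and c: "c > 0" and C: "C \<ge> 0" and r: "r \<ge> 2" "16 * C \<le> c * (real r)\<^sup>2"
    and v: "supported T v"
  shows "c / 16 * sqnorm p v \<le> bform p A v v"
proof (cases "sqnorm p v = 0")
  case True
  then show ?thesis by (simp add: bform_zero_of_sqnorm)
next
  case False
  then have pos: "sqnorm p v > 0" using sqnorm_nonneg[of p v] by simp
  then obtain u where u: "sqnorm p u = 1" "\<And>i. v i = 0 \<Longrightarrow> u i = 0"
    "\<And>A. bform p A v v = sqnorm p v * bform p A u u"
    using quadratic_form_scale_unit by metis
  have su: "supported T u" using u v by (auto simp: supported_def)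
  obtain z where z: "z \<in> lattice_net T r" "sqnorm p (\<lambda>i. u i - z i) \<le> 1 / (real r)\<^sup>2"
    using lattice_net_approximates[OF T _ su, of r] r u(1) by auto
  note sz = supported_lattice_net[OF z(1)]
  let ?d = "\<lambda>i. u i - z i"
  have r4: "1 / (real r)\<^sup>2 \<le> 1 / 4"
  proof -
    have "2\<^sup>2 \<le> (real r)\<^sup>2" using r by (intro power_mono) auto
    then show ?thesis using r by (intro divide_left_mono) auto
  qed
  have zd: "(\<lambda>i. z i + ?d i) = u" by auto
  have "sqnorm p u \<le> 2 * sqnorm p z + 2 * sqnorm p ?d"
    using sqnorm_parallelogram[of p z ?d] sqnorm_nonneg[of p "\<lambda>i. z i - ?d i"] unfolding zd by linarith
  then have "1 / 4 \<le> sqnorm p z" using u(1) z(2) r4 by linarith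
  then have "c * (1 / 4) \<le> c * sqnorm p z" using c by (intro mult_left_mono) auto
  then have 1: "c / 4 \<le> bform p A z z" using net[OF z(1)] by linarith
  have ud: "(\<lambda>i. u i - ?d i) = z" by auto
  have 2: "bform p A z z \<le> 2 * bform p A u u + 2 * bform p A ?d ?d"
    using bform_parallelogram[OF sym, of u ?d] psd[of "\<lambda>i. u i + ?d i"] unfolding ud by linarith
  have "bform p A ?d ?d \<le> C * sqnorm p ?d"
    by (intro upper supported_diff su sz)
  also have "\<dots> \<le> C * (1 / (real r)\<^sup>2)"
    using C z(2) by (intro mult_left_mono) auto
  also have "\<dots> \<le> c / 16"
    using r by (simp add: divide_simps)
  finally have "c / 16 \<le> bform p A u u" using 1 2 by linarith
  then show ?thesis
    unfolding u(3) using pos by (simp add: mult.commute)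
qed

section \<open>Restricted linear systems and their perturbation\<close>

definition solves_on :: "nat \<Rightarrow> nat set \<Rightarrow> real mat \<Rightarrow> nat \<Rightarrow> (nat \<Rightarrow> real) \<Rightarrow> bool" where
  "solves_on p T A i u \<longleftrightarrow> supported T u \<and>
     (\<forall>k\<in>T. (\<Sum>j<p. A $$ (k, j) * u j) = (if k = i then 1 else 0))"

text \<open>The linear system enters all estimates through this evaluation of a coordinate, which avoids any mention of the
inverse of a submatrix.\<close>

lemma bform_solves_on:
  assumes T: "T \<subseteq> {..<p}" and u: "solves_on p T A i u" and v: "supported T v"
  shows "bform p A v u = v i"
proof -
  have fin: "finite T" using T finite_subset by blast
  have "bform p A v u = (\<Sum>k<p. v k * (\<Sum>j<p. A $$ (k, j) * u j))"
    by (simp add: bform_def sum_distrib_left mult.assoc)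
  also have "\<dots> = (\<Sum>k\<in>T. v k * (\<Sum>j<p. A $$ (k, j) * u j))"
    using T v by (intro sum.mono_neutral_right) (auto simp: supported_def)
  also have "\<dots> = (\<Sum>k\<in>T. if k = i then v k else 0)"
    using u by (intro sum.cong) (auto simp: solves_on_def)
  also have "\<dots> = v i"
    using fin v by (simp add: supported_def)
  finally show ?thesis .
qed

lemma norm_solution_le:
  assumes T: "T \<subseteq> {..<p}" and i: "i < p" and c: "c > 0"
    and low: "\<And>v. supported T v \<Longrightarrow> c * sqnorm p v \<le> bform p A v v"
    and u: "solves_on p T A i u"
  shows "sqrt (sqnorm p u) \<le> 1 / c" "bform p A u u \<le> 1 / c"
proof -
  have su: "supported T u" using u by (simp add: solves_on_def)
  let ?a = "sqrt (sqnorm p u)"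
  have a0: "0 \<le> ?a" by (simp add: sqnorm_nonneg)
  have "\<bar>u i\<bar> \<le> ?a"
    using sqnorm_component_le[OF i, of u] by (intro real_le_rsqrt) simp
  then have ui: "bform p A u u \<le> ?a"
    using bform_solves_on[OF T u su] by simp
  have "c * ?a * ?a \<le> ?a"
    using low[OF su] ui by (simp add: mult.assoc sqnorm_nonneg)
  then have "c * ?a \<le> 1" if "?a \<noteq> 0"
    using a0 that mult_right_le_imp_le[of "c * ?a" ?a 1] by linarith
  then show *: "?a \<le> 1 / c"
    using c by (cases "?a = 0") (simp_all add: pos_le_divide_eq mult.commute)
  then show "bform p A u u \<le> 1 / c" using ui by linarith
qed

text \<open>Write \<open>d = u - w\<close> and \<open>\<Delta> = S - A\<close>. Against vectors supported on \<open>T\<close>, \<open>S d = - \<Delta> w\<close>. Testing with \<open>d\<close> itself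
bounds the norm of \<open>d\<close> by \<open>M / c\<close> times that of \<open>w\<close>; testing with \<open>q\<close> gives
\<open>d\<^sub>j = q \<bullet> A d = - q \<bullet> \<Delta> w - q \<bullet> \<Delta> d\<close>, whose second term is of second order in \<open>M\<close>. The term linear
in \<open>\<Delta>\<close> is kept, since bounding it by \<open>M\<close> would lose the rate.\<close>

lemma linear_system_perturbation:
  assumes T: "T \<subseteq> {..<p}" and S: "sym_entries p S" and A: "sym_entries p A" "A \<in> carrier_mat p p"
    and u: "solves_on p T S i u" and w: "solves_on p T A i w" and q: "solves_on p T A j q"
    and c: "c > 0" and M: "M \<ge> 0"
    and low: "\<And>v. supported T v \<Longrightarrow> c * sqnorm p v \<le> bform p S v v"
    and D: "\<And>v. supported T v \<Longrightarrow> \<bar>bform p (S - A) v v\<bar> \<le> M * sqnorm p v"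
  shows "\<bar>u j - w j\<bar> \<le> \<bar>bform p (S - A) q w\<bar> + M\<^sup>2 / c * sqrt (sqnorm p q) * sqrt (sqnorm p w)"
proof -
  note supp = u[unfolded solves_on_def, THEN conjunct1] w[unfolded solves_on_def, THEN conjunct1]
    q[unfolded solves_on_def, THEN conjunct1]
  have Dsym: "sym_entries p (S - A)"
    using S A by (auto simp: sym_entries_def)
  note Dform = bform_minus_mat[OF A(2), of S]
  note Dbound = bilinear_bound_of_quadratic_bound[OF Dsym _ _ D]
  define d where "d k = u k - w k" for k
  have sd: "supported T d" unfolding d_def by (intro supported_diff supp)
  have resid: "bform p S v d = - bform p (S - A) v w" if "supported T v" for v
  proof -
    have "bform p S v u = bform p A v w"
      using bform_solves_on[OF T u that] bform_solves_on[OF T w that] by simp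
    then show ?thesis unfolding d_def bform_diff_right Dform by simp
  qed
  let ?a = "sqrt (sqnorm p d)" and ?b = "sqrt (sqnorm p w)" and ?e = "sqrt (sqnorm p q)"
  have nonneg: "0 \<le> ?a" "0 \<le> ?b" "0 \<le> ?e" by (simp_all add: sqnorm_nonneg)
  have "c * ?a * ?a \<le> M * ?b * ?a"
  proof -
    have "c * ?a * ?a = c * sqnorm p d" by (simp add: mult.assoc sqnorm_nonneg)
    also have "\<dots> \<le> - bform p (S - A) d w" using low[OF sd] resid[OF sd] by simp
    also have "\<dots> \<le> M * ?a * ?b" using Dbound[OF sd supp(2)] by (simp add: abs_le_iff)
    finally show ?thesis by (simp add: ac_simps)
  qed
  then have "c * ?a \<le> M * ?b" if "?a \<noteq> 0"
    using nonneg(1) that mult_right_le_imp_le[of "c * ?a" ?a "M * ?b"] by linarith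
  then have a: "?a \<le> M / c * ?b"
    using c M nonneg by (cases "?a = 0") (simp_all add: pos_le_divide_eq mult.commute)
  have "d j = bform p A q d"
    using bform_solves_on[OF T q sd] bform_sym[OF A(1)] by metis
  also have "\<dots> = - bform p (S - A) q w - bform p (S - A) q d"
    using resid[OF supp(3)] Dform[of q d] by simp
  finally have "\<bar>d j\<bar> \<le> \<bar>bform p (S - A) q w\<bar> + \<bar>bform p (S - A) q d\<bar>" by linarith
  also have "\<bar>bform p (S - A) q d\<bar> \<le> M * ?e * ?a"
    by (rule Dbound[OF supp(3) sd])
  also have "\<dots> \<le> M * ?e * (M / c * ?b)"
    using a M nonneg by (intro mult_left_mono) auto
  finally show ?thesis by (simp add: d_def power2_eq_square field_simps)
qed

section \<open>The estimator as a restricted linear system\<close>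

lemma sorted_list_of_set_nth_mem:
  "finite T \<Longrightarrow> a < length (sorted_list_of_set T) \<Longrightarrow> sorted_list_of_set T ! a \<in> T"
  by (metis nth_mem set_sorted_list_of_set)

lemma selection_mat_carrier: "selection_mat p T \<in> carrier_mat p (length (sorted_list_of_set T))"
  by (simp add: selection_mat_def mat_of_cols_def)

lemma selection_mat_index:
  assumes "j < p" "a < length (sorted_list_of_set T)" "T \<subseteq> {..<p}"
  shows "selection_mat p T $$ (j, a) = (if j = sorted_list_of_set T ! a then 1 else 0)"
proof -
  have "finite T" using assms finite_subset by blast
  then have "sorted_list_of_set T ! a \<in> T"
    using assms(2) by (rule sorted_list_of_set_nth_mem)
  then have "sorted_list_of_set T ! a < p" using assms by auto
  then show ?thesis
    using assms by (auto simp: selection_mat_def mat_of_cols_index unit_vec_def)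
qed

lemma transpose_selection_mat_mult:
  assumes "a < length (sorted_list_of_set T)" "T \<subseteq> {..<p}" "x \<in> carrier_vec p"
  shows "(transpose_mat (selection_mat p T) *\<^sub>v x) $ a = x $ (sorted_list_of_set T ! a)"
proof -
  let ?xs = "sorted_list_of_set T"
  have "finite T" using assms finite_subset by blast
  then have "?xs ! a \<in> T"
    using assms(1) by (rule sorted_list_of_set_nth_mem)
  then have lt: "?xs ! a < p" using assms by auto
  have "(transpose_mat (selection_mat p T) *\<^sub>v x) $ a = (\<Sum>j<p. selection_mat p T $$ (j, a) * x $ j)"
    using assms selection_mat_carrier[of p T]
    by (simp add: scalar_prod_def lessThan_atLeast0)
  also have "\<dots> = (\<Sum>j<p. if j = ?xs ! a then x $ j else 0)"
    using assms by (intro sum.cong) (auto simp: selection_mat_index)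
  finally show ?thesis using lt by simp
qed

lemma selection_mat_mult:
  assumes T: "T \<subseteq> {..<p}" and y: "y \<in> carrier_vec (length (sorted_list_of_set T))" and j: "j < p"
  shows "j \<notin> T \<Longrightarrow> (selection_mat p T *\<^sub>v y) $ j = 0"
    and "a < length (sorted_list_of_set T) \<Longrightarrow> j = sorted_list_of_set T ! a \<Longrightarrow>
      (selection_mat p T *\<^sub>v y) $ j = y $ a"
proof -
  let ?xs = "sorted_list_of_set T"
  have fin: "finite T" using T finite_subset by blast
  have *: "(selection_mat p T *\<^sub>v y) $ j = (\<Sum>a<length ?xs. if j = ?xs ! a then y $ a else 0)"
  proof -
    have "(selection_mat p T *\<^sub>v y) $ j = (\<Sum>a<length ?xs. selection_mat p T $$ (j, a) * y $ a)"
      using j y selection_mat_carrier[of p T]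
      by (simp add: scalar_prod_def lessThan_atLeast0)
    also have "\<dots> = (\<Sum>a<length ?xs. if j = ?xs ! a then y $ a else 0)"
      using j T by (intro sum.cong) (auto simp: selection_mat_index)
    finally show ?thesis .
  qed
  show "(selection_mat p T *\<^sub>v y) $ j = 0" if "j \<notin> T"
    unfolding * using that sorted_list_of_set_nth_mem[OF fin] by (intro sum.neutral) auto
  show "(selection_mat p T *\<^sub>v y) $ j = y $ a" if a: "a < length ?xs" "j = ?xs ! a"
  proof -
    have "(\<Sum>b<length ?xs. if j = ?xs ! b then y $ b else 0) = (\<Sum>b<length ?xs. if b = a then y $ b else 0)"
      using a by (intro sum.cong) (auto simp: nth_eq_iff_index_eq)
    then show ?thesis unfolding * using a by simp
  qed
qed

text \<open>Positivity on the vectors supported on \<open>T\<close> makes the selected submatrix \<open>G\<close> invertible: a null vector \<open>y\<close> of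
\<open>G\<close> would give a vector \<open>B y\<close> supported on \<open>T\<close> at which the form of \<open>S\<close> vanishes.\<close>

lemma col_estimator_solves_on:
  assumes T: "T \<subseteq> {..<p}" and S: "S \<in> carrier_mat p p" and c: "c > 0"
    and low: "\<And>v. supported T v \<Longrightarrow> c * sqnorm p v \<le> bform p S v v"
  shows "solves_on p T S i (\<lambda>j. if j < p then col_estimator p T S i $ j else 0)"
proof -
  let ?xs = "sorted_list_of_set T"
  define s where "s = length ?xs"
  define B where "B = selection_mat p T"
  have fin: "finite T" using T finite_subset by blast
  have B: "B \<in> carrier_mat p s" unfolding B_def s_def by (rule selection_mat_carrier)
  define G where "G = transpose_mat B * S * B"
  have G: "G \<in> carrier_mat s s" using B S by (simp add: G_def)
  have Gy: "G *\<^sub>v y = transpose_mat B *\<^sub>v (S *\<^sub>v (B *\<^sub>v y))" if "y \<in> carrier_vec s" for y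
  proof -
    have "G *\<^sub>v y = (transpose_mat B * S) *\<^sub>v (B *\<^sub>v y)"
      unfolding G_def using B S that by (intro assoc_mult_mat_vec[of _ s p _ s]) auto
    also have "\<dots> = transpose_mat B *\<^sub>v (S *\<^sub>v (B *\<^sub>v y))"
      using B S that by (intro assoc_mult_mat_vec[of _ s p _ p]) auto
    finally show ?thesis .
  qed
  have "det G \<noteq> 0"
  proof
    assume "det G = 0"
    then obtain y where y: "y \<in> carrier_vec s" "y \<noteq> 0\<^sub>v s" "G *\<^sub>v y = 0\<^sub>v s"
      using det_0_iff_vec_prod_zero[OF G] by blast
    define v where "v j = (if j < p then (B *\<^sub>v y) $ j else 0)" for j
    have vec: "vec p v = B *\<^sub>v y"
      using B by (intro eq_vecI) (auto simp: v_def)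
    have sv: "supported T v"
      using selection_mat_mult(1)[OF T, of y] y by (auto simp: supported_def v_def B_def s_def)
    have "bform p S v v = (B *\<^sub>v y) \<bullet> (S *\<^sub>v (B *\<^sub>v y))"
      by (simp add: bform_scalar_prod[OF S] vec)
    also have "\<dots> = (S *\<^sub>v (B *\<^sub>v y)) \<bullet> (B *\<^sub>v y)"
      using B S y by (intro comm_scalar_prod[of _ p]) auto
    also have "\<dots> = (G *\<^sub>v y) \<bullet> y"
      unfolding Gy[OF y(1)] using B S y by (intro transpose_vec_mult_scalar[symmetric]) auto
    also have "\<dots> = 0" using y by simp
    finally have "c * sqnorm p v \<le> 0" using low[OF sv] by simp
    then have v0: "sqnorm p v = 0"
      using c sqnorm_nonneg[of p v] by (simp add: mult_le_0_iff)
    have "y = 0\<^sub>v s"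
    proof (rule eq_vecI)
      fix a assume "a < dim_vec (0\<^sub>v s :: real vec)"
      then have a: "a < length ?xs" by (simp add: s_def)
      then have "?xs ! a \<in> T" using fin by (intro sorted_list_of_set_nth_mem)
      then have lt: "?xs ! a < p" using T by auto
      have "v (?xs ! a) = y $ a"
        using selection_mat_mult(2)[OF T _ lt a, of y] y lt by (simp add: v_def B_def s_def)
      then show "y $ a = 0\<^sub>v s $ a"
        using sqnorm_eq_0[OF v0 lt] a by (simp add: s_def)
    qed (use y in simp)
    then show False using y by simp
  qed
  note inv = inv_mat_correct[OF G this]
  define r where "r = transpose_mat B *\<^sub>v unit_vec p i"
  have r: "r \<in> carrier_vec s" using B by (simp add: r_def)
  define y where "y = inv_mat G *\<^sub>v r"
  have y: "y \<in> carrier_vec s" using inv r by (simp add: y_def)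
  have Gyr: "transpose_mat B *\<^sub>v (S *\<^sub>v (B *\<^sub>v y)) = r"
  proof -
    have "G *\<^sub>v y = (G * inv_mat G) *\<^sub>v r"
      unfolding y_def using inv(1) G r by (intro assoc_mult_mat_vec[symmetric, of _ s s _ s]) auto
    also have "\<dots> = r" using inv(2) r by simp
    finally show ?thesis unfolding Gy[OF y] .
  qed
  have est: "col_estimator p T S i = B *\<^sub>v y"
    by (simp add: col_estimator_def Let_def B_def G_def y_def r_def)
  define u where "u j = (if j < p then (B *\<^sub>v y) $ j else 0)" for j
  have vec: "vec p u = B *\<^sub>v y"
    using B by (intro eq_vecI) (auto simp: u_def)
  have "supported T u"
    using selection_mat_mult(1)[OF T, of y] y by (auto simp: supported_def u_def B_def s_def)
  moreover have "(\<Sum>j<p. S $$ (k, j) * u j) = (if k = i then 1 else 0)" if k: "k \<in> T" for k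
  proof -
    have kp: "k < p" using k T by auto
    obtain a where a: "a < length ?xs" "?xs ! a = k"
      using k fin by (metis in_set_conv_nth set_sorted_list_of_set)
    have "(\<Sum>j<p. S $$ (k, j) * u j) = (S *\<^sub>v (B *\<^sub>v y)) $ k"
      unfolding vec[symmetric] using S kp by (simp add: scalar_prod_def lessThan_atLeast0)
    also have "\<dots> = (transpose_mat B *\<^sub>v (S *\<^sub>v (B *\<^sub>v y))) $ a"
    proof -
      have "S *\<^sub>v (B *\<^sub>v y) \<in> carrier_vec p" using S B y by auto
      then show ?thesis
        using transpose_selection_mat_mult[OF a(1) T] a(2) unfolding B_def by simp
    qed
    also have "\<dots> = r $ a"
      by (simp only: Gyr)
    also have "\<dots> = unit_vec p i $ k"
      using transpose_selection_mat_mult[OF a(1) T, of "unit_vec p i"] a(2) by (simp add: r_def B_def)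
    also have "\<dots> = (if k = i then 1 else 0)"
      using kp by (auto simp: unit_vec_def)
    finally show ?thesis .
  qed
  ultimately show ?thesis
    unfolding solves_on_def est u_def[symmetric] by auto
qed

section \<open>Measurability of the estimator\<close>

lemma borel_measurable_det:
  fixes A :: "'a \<Rightarrow> real mat"
  assumes "\<And>\<omega>. A \<omega> \<in> carrier_mat n n"
    and "\<And>i j. i < n \<Longrightarrow> j < n \<Longrightarrow> (\<lambda>\<omega>. A \<omega> $$ (i, j)) \<in> borel_measurable M"
  shows "(\<lambda>\<omega>. det (A \<omega>)) \<in> borel_measurable M"
  unfolding det_def'[OF assms(1)]
proof (intro borel_measurable_sum borel_measurable_times borel_measurable_const borel_measurable_prod assms(2))
  fix \<pi> i assume "\<pi> \<in> {\<pi>. \<pi> permutes {0..<n}}" "i \<in> {0..<n}"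
  then show "i < n" "\<pi> i < n"
    using permutes_in_image[of \<pi> "{0..<n}" i] by auto
qed

text \<open>Cramer's rule turns the inverse, which is defined by an elimination algorithm, into a rational function of the
entries. This is how measurability of the estimator is obtained.\<close>

lemma inv_mat_cofactor:
  assumes A: "A \<in> carrier_mat n n" and ij: "i < n" "j < n"
  shows "inv_mat A $$ (i, j) = (if det A = 0 then 0 else cofactor A j i / det A)"
proof (cases "det A = 0")
  case True
  have "mat_inverse A = None"
  proof (rule ccontr)
    assume "mat_inverse A \<noteq> None"
    then obtain B where "mat_inverse A = Some B" by blast
    note B = mat_inverse(2)[OF A this]
    have "det A * det B = det (1\<^sub>m n)"
      using B A det_mult by metis
    then show False using True by simp
  qed
  then show ?thesis using True A ij by (simp add: inv_mat_def)
next
  case False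
  note inv = inv_mat_correct[OF A False]
  have "adj_mat A = (inv_mat A * A) * adj_mat A"
    unfolding inv(3) using adj_mat[OF A] by simp
  also have "\<dots> = inv_mat A * (A * adj_mat A)"
    using inv(1) A adj_mat(1)[OF A] by (rule assoc_mult_mat)
  also have "\<dots> = inv_mat A * (det A \<cdot>\<^sub>m 1\<^sub>m n)"
    by (simp only: adj_mat(2)[OF A])
  also have "\<dots> = det A \<cdot>\<^sub>m (inv_mat A * 1\<^sub>m n)"
    using inv(1) by (intro mult_smult_distrib[of _ n n _ n]) auto
  also have "\<dots> = det A \<cdot>\<^sub>m inv_mat A"
    using inv(1) by simp
  finally have "adj_mat A $$ (i, j) = det A * inv_mat A $$ (i, j)"
    using inv(1) ij by simp
  then show ?thesis
    using False A ij by (simp add: adj_mat_def field_simps)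
qed

lemma borel_measurable_inv_mat:
  fixes A :: "'a \<Rightarrow> real mat"
  assumes A: "\<And>\<omega>. A \<omega> \<in> carrier_mat n n"
    and meas: "\<And>i j. i < n \<Longrightarrow> j < n \<Longrightarrow> (\<lambda>\<omega>. A \<omega> $$ (i, j)) \<in> borel_measurable M"
    and ij: "i < n" "j < n"
  shows "(\<lambda>\<omega>. inv_mat (A \<omega>) $$ (i, j)) \<in> borel_measurable M"
proof -
  have [measurable]: "(\<lambda>\<omega>. det (A \<omega>)) \<in> borel_measurable M"
    by (rule borel_measurable_det[OF A meas])
  have "(\<lambda>\<omega>. det (mat_delete (A \<omega>) j i)) \<in> borel_measurable M"
  proof (rule borel_measurable_det)
    show "mat_delete (A \<omega>) j i \<in> carrier_mat (n - 1) (n - 1)" for \<omega>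
      using mat_delete_carrier[OF A] by simp
    fix k l assume kl: "k < n - 1" "l < n - 1"
    have "mat_delete (A \<omega>) j i $$ (k, l) =
        A \<omega> $$ (if k < j then k else Suc k, if l < i then l else Suc l)" for \<omega>
      using A[of \<omega>] kl by (simp add: mat_delete_def)
    then show "(\<lambda>\<omega>. mat_delete (A \<omega>) j i $$ (k, l)) \<in> borel_measurable M"
      using kl by (simp add: meas)
  qed
  then have [measurable]: "(\<lambda>\<omega>. cofactor (A \<omega>) j i) \<in> borel_measurable M"
    unfolding cofactor_def by (intro borel_measurable_times borel_measurable_const)
  show ?thesis
    unfolding inv_mat_cofactor[OF A ij] by measurable
qed

lemma borel_measurable_col_estimator:
  fixes S :: "'a \<Rightarrow> real mat"
  assumes S: "\<And>\<omega>. S \<omega> \<in> carrier_mat p p"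
    and meas: "\<And>i j. i < p \<Longrightarrow> j < p \<Longrightarrow> (\<lambda>\<omega>. S \<omega> $$ (i, j)) \<in> borel_measurable M"
    and j: "j < p"
  shows "(\<lambda>\<omega>. col_estimator p T (S \<omega>) i $ j) \<in> borel_measurable M"
proof -
  define s where "s = length (sorted_list_of_set T)"
  define B where "B = selection_mat p T"
  have B: "B \<in> carrier_mat p s" unfolding B_def s_def by (rule selection_mat_carrier)
  define G where "G \<omega> = transpose_mat B * S \<omega> * B" for \<omega>
  have G: "G \<omega> \<in> carrier_mat s s" for \<omega> using B S[of \<omega>] by (simp add: G_def)
  have Gm: "(\<lambda>\<omega>. G \<omega> $$ (a, b)) \<in> borel_measurable M" if ab: "a < s" "b < s" for a b
  proof -
    have "G \<omega> $$ (a, b) = (\<Sum>k<p. B $$ (k, a) * (\<Sum>l<p. S \<omega> $$ (k, l) * B $$ (l, b)))" for \<omega>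
      using B S[of \<omega>] ab by (simp add: G_def scalar_prod_def lessThan_atLeast0)
    then show ?thesis
      by (simp only:) (intro borel_measurable_sum borel_measurable_times borel_measurable_const meas; simp)
  qed
  define r where "r = transpose_mat B *\<^sub>v unit_vec p i"
  have r: "r \<in> carrier_vec s" using B by (simp add: r_def)
  have inv: "inv_mat (G \<omega>) \<in> carrier_mat s s" for \<omega>
    using mat_inverse(2)[OF G] G[of \<omega>] by (cases "mat_inverse (G \<omega>)") (auto simp: inv_mat_def)
  have "col_estimator p T (S \<omega>) i $ j = (\<Sum>a<s. B $$ (j, a) * (\<Sum>b<s. inv_mat (G \<omega>) $$ (a, b) * r $ b))" for \<omega>
    using B r inv[of \<omega>] j
    by (simp add: col_estimator_def Let_def B_def[symmetric] r_def[symmetric] G_def[symmetric]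
        scalar_prod_def lessThan_atLeast0)
  then show ?thesis
    by (simp only:) (intro borel_measurable_sum borel_measurable_times borel_measurable_const
        borel_measurable_inv_mat[OF G Gm]; simp)
qed

section \<open>The estimation error\<close>

text \<open>The extension by zero makes the vector supported on \<open>T\<close>; entries of a vector beyond its dimension are unspecified.\<close>
definition restricted_inverse_column :: "nat \<Rightarrow> nat set \<Rightarrow> real mat \<Rightarrow> nat \<Rightarrow> nat \<Rightarrow> real" where
  "restricted_inverse_column p T A i = (\<lambda>j. if j < p then col_estimator p T A i $ j else 0)"

text \<open>The deterministic core. The coarse net bounds \<open>\<Delta>\<close> on \<open>T\<close> by \<open>M = 2 t / C0\<close>, the fine net bounds \<open>S\<close> from
below by \<open>c C0 / 16\<close>, and the pairs of fixed vectors bound the linear term by \<open>t' / C0\<close>. The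
quadratic term is \<open>M\<^sup>2\<close> divided by that lower bound, times the norms of \<open>q\<close> and \<open>w\<close>, each at
most \<open>1 / C0\<close>.\<close>

lemma col_estimator_error:
  assumes T: "T \<subseteq> {..<p}" "T \<noteq> {}" and i: "i < p"
    and S: "S \<in> carrier_mat p p" "sym_entries p S" and psd: "\<And>v. 0 \<le> bform p S v v"
    and A: "A \<in> carrier_mat p p" "sym_entries p A" and C0: "C0 > 0"
    and A_low: "\<And>v. C0 * sqnorm p v \<le> bform p A v v"
    and A_upp: "\<And>v. bform p A v v \<le> 1 / C0 * sqnorm p v"
    and w: "solves_on p T A i w"
    and t: "t \<ge> 0" and t': "t' \<ge> 0" and c: "c > 0"
    and r: "r \<ge> 2" "16 * ((1 + 2 * t) / C0) \<le> c * C0 * (real r)\<^sup>2"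
    and coarse: "\<And>z. z \<in> lattice_net T 4 \<Longrightarrow> \<bar>bform p S z z - bform p A z z\<bar> \<le> t * bform p A z z"
    and fine: "\<And>z. z \<in> lattice_net T r \<Longrightarrow> c * bform p A z z \<le> bform p S z z"
    and pairs: "\<And>j z. j \<in> T \<Longrightarrow>
      z \<in> {\<lambda>k. restricted_inverse_column p T A j k + w k, \<lambda>k. restricted_inverse_column p T A j k - w k} \<Longrightarrow>
      \<bar>bform p S z z - bform p A z z\<bar> \<le> t' * bform p A z z"
    and j: "j < p"
  shows "\<bar>col_estimator p T S i $ j - w j\<bar> \<le> t' / C0 + 64 * t\<^sup>2 / (c * C0 ^ 5)"
proof -
  have sw: "supported T w" using w by (simp add: solves_on_def)
  have Dsym: "sym_entries p (S - A)"
    using S A by (auto simp: sym_entries_def)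
  note Dform = bform_minus_mat[OF A(1), of S]
  define M where "M = 2 * (t / C0)"
  have M: "M \<ge> 0" using t C0 by (simp add: M_def)
  have D: "\<bar>bform p (S - A) v v\<bar> \<le> M * sqnorm p v" if "supported T v" for v
    unfolding M_def
  proof (rule net_controls_quadratic_form[OF Dsym T _ that])
    fix z assume z: "z \<in> lattice_net T 4" "sqnorm p z \<le> 1"
    have "\<bar>bform p (S - A) z z\<bar> \<le> t * bform p A z z"
      unfolding Dform by (rule coarse[OF z(1)])
    also have "\<dots> \<le> t * (1 / C0 * 1)"
      using A_upp[of z] z(2) C0 t
      by (intro mult_left_mono order.trans[OF A_upp] mult_mono) auto
    finally show "\<bar>bform p (S - A) z z\<bar> \<le> t / C0" by simp
  qed
  have S_upp: "bform p S v v \<le> (1 + 2 * t) / C0 * sqnorm p v" if "supported T v" for v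
    using D[OF that] A_upp[of v] unfolding Dform M_def
    by (simp add: abs_le_iff add_divide_distrib algebra_simps)
  have S_low: "c * C0 / 16 * sqnorm p v \<le> bform p S v v" if "supported T v" for v
  proof (rule net_lower_bound_quadratic_form[OF S(2) T psd S_upp])
    fix z assume "z \<in> lattice_net T r"
    have "c * (C0 * sqnorm p z) \<le> c * bform p A z z"
      using c A_low[of z] by (intro mult_left_mono) auto
    then show "c * C0 * sqnorm p z \<le> bform p S z z"
      using fine[OF \<open>z \<in> lattice_net T r\<close>] by (simp add: mult.assoc)
  qed (use that r c C0 t in auto)
  have c': "c * C0 / 16 > 0" using c C0 by simp
  define u where "u = restricted_inverse_column p T S i"
  have u: "solves_on p T S i u"
    unfolding u_def restricted_inverse_column_def by (rule col_estimator_solves_on[OF T(1) S(1) c' S_low])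
  have uj: "u j = col_estimator p T S i $ j" using j by (simp add: u_def restricted_inverse_column_def)
  have rhs0: "0 \<le> t' / C0 + 64 * t\<^sup>2 / (c * C0 ^ 5)"
    using t' C0 c by simp
  show ?thesis
  proof (cases "j \<in> T")
    case False
    then show ?thesis
      using u sw rhs0 unfolding uj[symmetric] by (simp add: solves_on_def supported_def)
  next
    case True
    define q where "q = restricted_inverse_column p T A j"
    have q: "solves_on p T A j q"
      unfolding q_def restricted_inverse_column_def by (rule col_estimator_solves_on[OF T(1) A(1) C0 A_low])
    note nq = norm_solution_le[OF T(1) j C0 A_low q]
    note nw = norm_solution_le[OF T(1) i C0 A_low w]
    have "4 * \<bar>bform p (S - A) q w\<bar> \<le>
        \<bar>bform p (S - A) (\<lambda>k. q k + w k) (\<lambda>k. q k + w k)\<bar> + \<bar>bform p (S - A) (\<lambda>k. q k - w k) (\<lambda>k. q k - w k)\<bar>"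
      using bform_polarization[OF Dsym, of q w] by linarith
    also have "\<dots> \<le> t' * bform p A (\<lambda>k. q k + w k) (\<lambda>k. q k + w k) + t' * bform p A (\<lambda>k. q k - w k) (\<lambda>k. q k - w k)"
      unfolding Dform by (intro add_mono pairs[OF True]) (auto simp: q_def)
    also have "\<dots> = t' * (2 * bform p A q q + 2 * bform p A w w)"
      unfolding distrib_left[symmetric] bform_parallelogram[OF A(2)] ..
    also have "\<dots> \<le> t' * (2 * (1 / C0) + 2 * (1 / C0))"
      using nq(2) nw(2) t' by (intro mult_left_mono add_mono) auto
    also have "\<dots> = 4 * (t' / C0)" by simp
    finally have main: "\<bar>bform p (S - A) q w\<bar> \<le> t' / C0" by linarith
    have "\<bar>u j - w j\<bar> \<le> \<bar>bform p (S - A) q w\<bar> + M\<^sup>2 / (c * C0 / 16) * sqrt (sqnorm p q) * sqrt (sqnorm p w)"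
      by (rule linear_system_perturbation[OF T(1) S(2) A(2,1) u w q c' M S_low D])
    also have "M\<^sup>2 / (c * C0 / 16) * sqrt (sqnorm p q) * sqrt (sqnorm p w) \<le> M\<^sup>2 / (c * C0 / 16) * (1 / C0) * (1 / C0)"
      using nq(1) nw(1) c C0 by (intro mult_mono) (auto simp: sqnorm_nonneg)
    also have "\<dots> = 64 * t\<^sup>2 / (c * C0 ^ 5)"
      using c C0 by (simp add: M_def power_divide power_mult_distrib field_simps) (simp add: power2_eq_square numeral_eq_Suc)
    finally show ?thesis using main by (simp add: uj)
  qed
qed

lemma bform_sample_cov_nonneg:
  assumes "n \<ge> 1"
  shows "0 \<le> bform p (sample_cov p n x) v v"
proof -
  have "0 \<le> centered_sum_squares n y" for y
  proof -
    have "(\<Sum>k<n. y k)\<^sup>2 \<le> (\<Sum>k<n. (y k)\<^sup>2) * real n"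
      using Cauchy_Schwarz_ineq_sum[of y "\<lambda>_. 1" "{..<n}"] by simp
    then show ?thesis
      using assms by (simp add: centered_sum_squares_def pos_divide_le_eq)
  qed
  then show ?thesis
    using assms by (simp add: bform_sample_cov[where m = "\<lambda>_. 0"])
qed

lemma (in prob_space) union_bound:
  assumes I: "finite I" "real (card I) \<le> N"
    and meas: "\<And>i. i \<in> I \<Longrightarrow> {\<omega> \<in> space M. P i \<omega>} \<in> sets M"
    and le: "\<And>i. i \<in> I \<Longrightarrow> prob {\<omega> \<in> space M. \<not> P i \<omega>} \<le> B" and B: "B \<ge> 0"
  shows "prob {\<omega> \<in> space M. \<not> (\<forall>i\<in>I. P i \<omega>)} \<le> N * B"
proof -
  have "{\<omega> \<in> space M. \<not> P i \<omega>} = space M - {\<omega> \<in> space M. P i \<omega>}" for i by auto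
  then have meas': "{\<omega> \<in> space M. \<not> P i \<omega>} \<in> sets M" if "i \<in> I" for i
    using meas[OF that] by simp
  have "{\<omega> \<in> space M. \<not> (\<forall>i\<in>I. P i \<omega>)} = (\<Union>i\<in>I. {\<omega> \<in> space M. \<not> P i \<omega>})" by auto
  then have "prob {\<omega> \<in> space M. \<not> (\<forall>i\<in>I. P i \<omega>)} \<le> (\<Sum>i\<in>I. prob {\<omega> \<in> space M. \<not> P i \<omega>})"
    using I meas' by (simp only:) (intro finite_measure_subadditive_finite; auto)
  also have "\<dots> \<le> (\<Sum>i\<in>I. B)" by (intro sum_mono le)
  also have "\<dots> \<le> N * B" using I B by (simp add: mult_right_mono)
  finally show ?thesis .
qed

context gaussian_sample begin

lemma S_carrier: "S \<omega> \<in> carrier_mat p p"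
  by (simp add: S_def sample_cov_def)

lemma S_sym_entries: "sym_entries p (S \<omega>)"
  by (simp add: sym_entries_def S_def sample_cov_def mult.commute)

lemma deviation_event [measurable]:
  "{\<omega> \<in> space M. \<bar>bform p (S \<omega>) z z - a\<bar> \<le> b} \<in> sets M"
  "{\<omega> \<in> space M. a \<le> bform p (S \<omega>) z z} \<in> sets M"
proof -
  note [measurable] = bform_S_measurable
  show "{\<omega> \<in> space M. \<bar>bform p (S \<omega>) z z - a\<bar> \<le> b} \<in> sets M"
    "{\<omega> \<in> space M. a \<le> bform p (S \<omega>) z z} \<in> sets M"
    by measurable
qed

text \<open>There are about \<open>p 48\<^sup>s\<close> events for the coarse nets, \<open>2 p\<^sup>2\<close> events for the pairs, and \<open>p (3 2\<^sup>r)\<^sup>s\<close> events for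
the fine nets. The tails \<open>exp (- 8 x)\<close> with \<open>x = s + ln p\<close>, \<open>exp (- 8 ln p)\<close> and
\<open>exp (- (D + 2) n)\<close> outweigh these numbers. The bound \<open>\<beta>\<close> is left free so that the event can be measured at exactly
the level at which it is needed.\<close>

lemma precision_estimation_error:
  fixes T :: "nat \<Rightarrow> nat set" and w :: "nat \<Rightarrow> nat \<Rightarrow> real" and s r :: nat and b c C0 D x \<beta> :: real
  assumes T: "\<And>i. i < p \<Longrightarrow> T i \<subseteq> {..<p}" "\<And>i. i < p \<Longrightarrow> card (T i) = s" and s: "s \<ge> 1"
    and w: "\<And>i. i < p \<Longrightarrow> solves_on p (T i) \<Sigma> i (w i)"
    and C0: "C0 > 0"
    and low: "\<And>v. C0 * sqnorm p v \<le> bform p \<Sigma> v v"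
    and upp: "\<And>v. bform p \<Sigma> v v \<le> 1 / C0 * sqnorm p v"
    and n: "n \<ge> 2" and p: "ln (real p) \<ge> 1" "p \<ge> 1"
    and D: "D \<ge> 0" "ln (real p) \<le> D * real n" "real s * ln (3 * 2 ^ r) \<le> real n"
    and x: "x = real s + ln (real p)"
    and b: "b > 0" "b * sqrt (x / n) \<le> 1 / 4" and K: "K = 2 / b * (8 + 4 * b\<^sup>2 + 1)"
    and c: "c = 2 / (exp (4 * ((D + 2) + 1)) - 1)"
    and r: "r \<ge> 2" "16 * ((1 + 2 * (K / (4 * b))) / C0) \<le> c * C0 * (real r)\<^sup>2"
    and \<beta>: "K * sqrt (ln (real p) / n) / C0 + 64 * (K * sqrt (x / n))\<^sup>2 / (c * C0 ^ 5) \<le> \<beta>"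
  shows "prob {\<omega> \<in> space M. \<forall>i<p. \<forall>j<p. \<bar>col_estimator p (T i) (S \<omega>) i $ j - w i j\<bar> \<le> \<beta>} \<ge> 1 - (6 / p + exp (- real n))"
    (is "prob {\<omega> \<in> space M. ?E \<omega>} \<ge> _")
proof -
  let ?L = "ln (real p)"
  define t where "t = K * sqrt (x / n)"
  define t' where "t' = K * sqrt (?L / n)"
  have K0: "K > 0" using b by (simp add: K add_pos_nonneg)
  have c0: "c > 0" using D by (simp add: c)
  have x1: "x \<ge> 1" "?L \<le> x" using s p by (simp_all add: x)
  have p_exp: "real p = exp ?L" using p by simp
  have t0: "t \<ge> 0" "t' \<ge> 0" using K0 x1 p by (simp_all add: t_def t'_def)
  have fin: "finite (T i)" if "i < p" for i using T(1)[OF that] finite_subset by blast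
  have ne: "T i \<noteq> {}" if "i < p" for i using T(2)[OF that] s by auto
  have bL: "b * sqrt (?L / n) \<le> 1 / 4"
  proof -
    have "sqrt (?L / n) \<le> sqrt (x / n)"
      using x1 by (intro real_sqrt_le_mono divide_right_mono) auto
    then have "b * sqrt (?L / n) \<le> b * sqrt (x / n)" using b by (intro mult_left_mono) auto
    then show ?thesis using b by linarith
  qed
  define I1 where "I1 = (SIGMA i:{..<p}. lattice_net (T i) 4)"
  define I2 where "I2 = (SIGMA i:{..<p}. lattice_net (T i) r)"
  \<comment> \<open>The sign \<open>\<sigma>\<close> selects the sum or the difference of the two vectors in the polarization.\<close>
  define I3 where "I3 = {..<p} \<times> {..<p} \<times> {-1, 1::real}"
  define P1 where "P1 = (\<lambda>(i::nat, z) \<omega>. \<bar>bform p (S \<omega>) z z - bform p \<Sigma> z z\<bar> \<le> t * bform p \<Sigma> z z)"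
  define P2 where "P2 = (\<lambda>(i::nat, z) \<omega>. c * bform p \<Sigma> z z \<le> bform p (S \<omega>) z z)"
  define y where "y i j \<sigma> k = restricted_inverse_column p (T i) \<Sigma> j k + \<sigma> * w i k" for i j k and \<sigma> :: real
  define P3 where "P3 = (\<lambda>(i, j, \<sigma>) \<omega>. \<bar>bform p (S \<omega>) (y i j \<sigma>) (y i j \<sigma>) - bform p \<Sigma> (y i j \<sigma>) (y i j \<sigma>)\<bar> \<le>
    t' * bform p \<Sigma> (y i j \<sigma>) (y i j \<sigma>))"
  have meas[measurable]: "{\<omega> \<in> space M. P1 k \<omega>} \<in> sets M" "{\<omega> \<in> space M. P2 k \<omega>} \<in> sets M"
    "{\<omega> \<in> space M. P3 k' \<omega>} \<in> sets M" for k k'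
    by (cases k; cases k'; simp add: P1_def P2_def P3_def deviation_event)+
  have net_card: "real (card (SIGMA i:{..<p}. lattice_net (T i) m)) \<le> real p * (3 * 2 ^ m) ^ s" for m
  proof -
    have "real (card (SIGMA i:{..<p}. lattice_net (T i) m)) = (\<Sum>i<p. real (card (lattice_net (T i) m)))"
      using fin by (subst card_SigmaI) (auto intro: finite_lattice_net)
    also have "\<dots> \<le> (\<Sum>i<p. (3 * 2 ^ m) ^ s)"
      using card_lattice_net[OF fin] T(2) by (intro sum_mono) auto
    finally show ?thesis by simp
  qed
  have finI: "finite I1" "finite I2" "finite I3"
    using fin by (auto simp: I1_def I2_def I3_def intro: finite_lattice_net)
  have 1: "prob {\<omega> \<in> space M. \<not> (\<forall>k\<in>I1. P1 k \<omega>)} \<le> 2 * exp (- ?L)"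
  proof -
    have "prob {\<omega> \<in> space M. \<not> P1 k \<omega>} \<le> 2 * exp (- 8 * x)" for k
      using quadratic_form_deviation[OF n x1(1) b K, of "snd k"] by (cases k) (simp add: P1_def t_def)
    then have "prob {\<omega> \<in> space M. \<not> (\<forall>k\<in>I1. P1 k \<omega>)} \<le> (real p * (3 * 2 ^ 4) ^ s) * (2 * exp (- 8 * x))"
      using net_card[of 4] finI(1) by (intro union_bound meas) (auto simp: I1_def)
    also have "(3 * 2 ^ 4 :: real) ^ s \<le> exp (real s * 5)"
    proof -
      \<comment> \<open>The net size \<open>48\<^sup>s\<close> is at most \<open>exp (5 s)\<close>, which \<open>exp (- 8 s)\<close> outweighs.\<close>
      have "(5 / 2 :: real) \<le> exp 1"
        using exp_lower_Taylor_quadratic[of 1] by simp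
      then have "(5 / 2 :: real) ^ 5 \<le> exp 1 ^ 5" by (intro power_mono) auto
      then have "3 * 2 ^ 4 \<le> exp (5::real)"
        by (simp add: exp_of_nat_mult[symmetric] power_divide)
      then have "(3 * 2 ^ 4 :: real) ^ s \<le> exp 5 ^ s" by (intro power_mono) auto
      then show ?thesis by (simp add: exp_of_nat_mult)
    qed
    also have "real p * exp (real s * 5) * (2 * exp (- 8 * x)) = 2 * exp (?L + real s * 5 - 8 * x)"
      by (subst p_exp) (simp add: mult_exp_exp algebra_simps)
    also have "\<dots> \<le> 2 * exp (- ?L)"
      using p s by (simp add: x)
    finally show ?thesis by (simp add: mult_left_mono mult_right_mono)
  qed
  have 2: "prob {\<omega> \<in> space M. \<not> (\<forall>k\<in>I2. P2 k \<omega>)} \<le> exp (- real n)"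
  proof -
    have "prob {\<omega> \<in> space M. \<not> P2 k \<omega>} \<le> exp (- (D + 2) * n)" for k
      using quadratic_form_small_ball[OF n _ c, of "snd k"] D by (cases k) (simp add: P2_def)
    then have "prob {\<omega> \<in> space M. \<not> (\<forall>k\<in>I2. P2 k \<omega>)} \<le> (real p * (3 * 2 ^ r) ^ s) * exp (- (D + 2) * n)"
      using net_card[of r] finI(2) by (intro union_bound meas) (auto simp: I2_def)
    also have "(3 * 2 ^ r :: real) ^ s = exp (real s * ln (3 * 2 ^ r))"
      by (simp add: exp_of_nat_mult)
    also have "real p * exp (real s * ln (3 * 2 ^ r)) * exp (- (D + 2) * n) =
        exp (?L + real s * ln (3 * 2 ^ r) - (D + 2) * n)"
      by (subst p_exp) (simp add: mult_exp_exp algebra_simps)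
    also have "\<dots> \<le> exp (- real n)"
      using D by (simp add: algebra_simps)
    finally show ?thesis .
  qed
  have 3: "prob {\<omega> \<in> space M. \<not> (\<forall>k\<in>I3. P3 k \<omega>)} \<le> 4 * exp (- ?L)"
  proof -
    have "prob {\<omega> \<in> space M. \<not> P3 k \<omega>} \<le> 2 * exp (- 8 * ?L)" for k
      using quadratic_form_deviation[OF n p(1) b(1) bL K, of "y (fst k) (fst (snd k)) (snd (snd k))"]
      by (cases k) (simp add: P3_def t'_def)
    moreover have "real (card I3) \<le> 2 * (real p * real p)"
      by (simp add: I3_def card_cartesian_product)
    ultimately have "prob {\<omega> \<in> space M. \<not> (\<forall>k\<in>I3. P3 k \<omega>)} \<le> (2 * (real p * real p)) * (2 * exp (- 8 * ?L))"
      using finI(3) by (intro union_bound meas) auto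
    also have "\<dots> = 4 * exp (- 6 * ?L)"
      by (subst (1 2) p_exp) (simp add: mult_exp_exp)
    also have "\<dots> \<le> 4 * exp (- ?L)"
      using p by simp
    finally show ?thesis .
  qed
  have imp: "?E \<omega>" if g: "\<forall>k\<in>I1. P1 k \<omega>" "\<forall>k\<in>I2. P2 k \<omega>" "\<forall>k\<in>I3. P3 k \<omega>" for \<omega>
  proof (intro allI impI)
    fix i j assume ij: "i < p" "j < p"
    have t_le: "t \<le> K / (4 * b)"
    proof -
      have "sqrt (x / n) \<le> 1 / (4 * b)" using b by (simp add: field_simps)
      then have "K * sqrt (x / n) \<le> K * (1 / (4 * b))" using K0 by (intro mult_left_mono) auto
      then show ?thesis by (simp add: t_def)
    qed
    have "16 * ((1 + 2 * t) / C0) \<le> 16 * ((1 + 2 * (K / (4 * b))) / C0)"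
      using t_le C0 by (intro mult_left_mono divide_right_mono) auto
    then have r2: "16 * ((1 + 2 * t) / C0) \<le> c * C0 * (real r)\<^sup>2" using r(2) by linarith
    have A: "\<Sigma> \<in> carrier_mat p p" "sym_entries p \<Sigma>"
      using spd sym_pos_def_sym_entries by (auto simp: sym_pos_def_def)
    have "\<bar>col_estimator p (T i) (S \<omega>) i $ j - w i j\<bar> \<le> t' / C0 + 64 * t\<^sup>2 / (c * C0 ^ 5)"
    proof (rule col_estimator_error[OF T(1)[OF ij(1)] ne[OF ij(1)] ij(1) S_carrier S_sym_entries _ A C0 low upp
          w[OF ij(1)] t0 c0 r(1) r2 _ _ _ ij(2)])
      show "0 \<le> bform p (S \<omega>) v v" for v
        unfolding S_def using n by (intro bform_sample_cov_nonneg) auto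
      show "\<bar>bform p (S \<omega>) z z - bform p \<Sigma> z z\<bar> \<le> t * bform p \<Sigma> z z" if "z \<in> lattice_net (T i) 4" for z
        using g(1) that ij by (auto simp: I1_def P1_def)
      show "c * bform p \<Sigma> z z \<le> bform p (S \<omega>) z z" if "z \<in> lattice_net (T i) r" for z
        using g(2) that ij by (auto simp: I2_def P2_def)
      fix k z assume k: "k \<in> T i" and z: "z \<in> {\<lambda>l. restricted_inverse_column p (T i) \<Sigma> k l + w i l,
          \<lambda>l. restricted_inverse_column p (T i) \<Sigma> k l - w i l}"
      have kp: "k < p" using k T(1)[OF ij(1)] by auto
      have "z = y i k 1 \<or> z = y i k (-1)"
        using z by (auto simp: y_def fun_eq_iff)
      then obtain \<sigma> where "z = y i k \<sigma>" "\<sigma> \<in> {-1, 1}" by blast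
      moreover from this have "(i, k, \<sigma>) \<in> I3" using kp ij by (simp add: I3_def)
      ultimately show "\<bar>bform p (S \<omega>) z z - bform p \<Sigma> z z\<bar> \<le> t' * bform p \<Sigma> z z"
        using g(3) by (auto simp: P3_def)
    qed
    then show "\<bar>col_estimator p (T i) (S \<omega>) i $ j - w i j\<bar> \<le> \<beta>"
      using \<beta> by (simp add: t_def t'_def)
  qed
  have Emeas: "{\<omega> \<in> space M. ?E \<omega>} \<in> sets M"
  proof -
    have [measurable]: "(\<lambda>\<omega>. col_estimator p (T i) (S \<omega>) i $ j) \<in> borel_measurable M" if "j < p" for i j
      using S_carrier S_entry_measurable that by (rule borel_measurable_col_estimator)
    have "{\<omega> \<in> space M. \<forall>i\<in>{..<p}. \<forall>j\<in>{..<p}. \<bar>col_estimator p (T i) (S \<omega>) i $ j - w i j\<bar> \<le> \<beta>} \<in> sets M"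
      by (intro sets.sets_Collect_finite_All) auto
    then show ?thesis by (simp add: Ball_def)
  qed
  let ?B1 = "{\<omega> \<in> space M. \<not> (\<forall>k\<in>I1. P1 k \<omega>)}"
  let ?B2 = "{\<omega> \<in> space M. \<not> (\<forall>k\<in>I2. P2 k \<omega>)}"
  let ?B3 = "{\<omega> \<in> space M. \<not> (\<forall>k\<in>I3. P3 k \<omega>)}"
  have G: "{\<omega> \<in> space M. \<forall>k\<in>I1. P1 k \<omega>} \<in> sets M" "{\<omega> \<in> space M. \<forall>k\<in>I2. P2 k \<omega>} \<in> sets M"
    "{\<omega> \<in> space M. \<forall>k\<in>I3. P3 k \<omega>} \<in> sets M"
    by (intro sets.sets_Collect_finite_All meas finI)+
  note B = G[THEN sets.sets_Collect_neg]
  have "space M - {\<omega> \<in> space M. ?E \<omega>} \<subseteq> ?B1 \<union> ?B2 \<union> ?B3"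
    using imp by blast
  then have "prob (space M - {\<omega> \<in> space M. ?E \<omega>}) \<le> prob (?B1 \<union> ?B2 \<union> ?B3)"
    using B by (intro finite_measure_mono) auto
  also have "\<dots> \<le> prob (?B1 \<union> ?B2) + prob ?B3"
    using B by (intro measure_Un_le) auto
  also have "\<dots> \<le> prob ?B1 + prob ?B2 + prob ?B3"
    using B by (intro add_right_mono measure_Un_le) auto
  also have "\<dots> \<le> 6 * exp (- ?L) + exp (- real n)"
    using 1 2 3 by linarith
  also have "6 * exp (- ?L) = 6 / p"
    using p by (simp add: exp_minus divide_inverse)
  finally show ?thesis
    using prob_compl[OF Emeas] by linarith
qed

end

lemma solves_on_inverse_column:
  assumes spd: "sym_pos_def p A" and i: "i < p"
  shows "solves_on p (col_support (inv_mat A) i) A i (\<lambda>j. if j < p then inv_mat A $$ (j, i) else 0)"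
proof -
  have A: "A \<in> carrier_mat p p" using spd by (simp add: sym_pos_def_def)
  note inv = inv_mat_correct[OF A sym_pos_def_det[OF spd]]
  have "(\<Sum>j<p. A $$ (k, j) * inv_mat A $$ (j, i)) = (if k = i then 1 else 0)" if "k < p" for k
  proof -
    have "(\<Sum>j<p. A $$ (k, j) * inv_mat A $$ (j, i)) = (A * inv_mat A) $$ (k, i)"
      using A inv(1) that i by (simp add: scalar_prod_def lessThan_atLeast0)
    then show ?thesis using inv(2) that i by simp
  qed
  then show ?thesis
    using inv(1) by (auto simp: solves_on_def supported_def col_support_def)
qed

text \<open>The outer absolute value disappears only because the index set is nonempty.\<close>

lemma abs_Max_le_iff:
  fixes f :: "nat \<Rightarrow> nat \<Rightarrow> real"
  assumes "p \<ge> 1"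
  shows "\<bar>MAX (i, j) \<in> {..<p} \<times> {..<p}. \<bar>f i j\<bar>\<bar> \<le> \<beta> \<longleftrightarrow> (\<forall>i<p. \<forall>j<p. \<bar>f i j\<bar> \<le> \<beta>)"
proof -
  let ?A = "(\<lambda>(i, j). \<bar>f i j\<bar>) ` ({..<p} \<times> {..<p})"
  have fin: "finite ?A" by simp
  have mem: "\<bar>f 0 0\<bar> \<in> ?A" using assms by force
  then have "0 \<le> Max ?A"
    using Max_ge[OF fin mem] abs_ge_zero[of "f 0 0"] by linarith
  moreover have "?A \<noteq> {}" using mem by blast
  ultimately show ?thesis
    using fin by (simp add: Max_le_iff) auto
qed

theorem theorem3:
  fixes M :: "nat \<Rightarrow> 'a measure"
    and X :: "nat \<Rightarrow> nat \<Rightarrow> 'a \<Rightarrow> nat \<Rightarrow> real"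
    and p s0 :: "nat \<Rightarrow> nat"
    and \<mu> :: "nat \<Rightarrow> real vec"
    and \<Sigma> \<Omega> :: "nat \<Rightarrow> real mat"
    and C0 C1 :: real
  assumes prob: "\<And>n. prob_space (M n)"
    and p_pos: "\<And>n. p n \<ge> 1"
    and p_lim: "filterlim p at_top sequentially"
    and p_rate: "(\<lambda>n. ln (real (p n))) \<in> O(\<lambda>n. real n)"
    and mean: "\<And>n. \<mu> n \<in> carrier_vec (p n)"
    and spd: "\<And>n. sym_pos_def (p n) (\<Sigma> n)"
    and indep: "\<And>n. prob_space.indep_vars (M n)
                  (\<lambda>_. Pi\<^sub>M {..<p n} (\<lambda>_. lborel)) (X n) {..<n}"
    and normal: "\<And>n k. k < n \<Longrightarrow> normal_vec (M n) (p n) (\<mu> n) (\<Sigma> n) (X n k)"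
    and prec: "\<And>n. \<Omega> n = inv_mat (\<Sigma> n)"
    and s0_pos: "\<And>n. s0 n \<ge> 1"
    and sparse: "\<And>n i. i < p n \<Longrightarrow> card (col_support (\<Omega> n) i) = s0 n"
    and s0_rate: "(\<lambda>n. real (s0 n)) \<in> o(\<lambda>n. sqrt (real n))"
    and C0: "C0 > 0"
    and spectrum: "\<And>n k. eigenvalue (\<Sigma> n) k \<Longrightarrow> C0 \<le> k \<and> k \<le> inverse C0"
    and norm1: "\<And>n. norm1_mat (\<Omega> n) \<le> C1"
  shows "bigO_P M
           (\<lambda>n \<omega>. MAX (i, j) \<in> {..<p n} \<times> {..<p n}.
              \<bar>precision_estimator (p n) (col_support (\<Omega> n)) n (\<lambda>k. X n k \<omega>) $$ (i, j)
                 - \<Omega> n $$ (i, j)\<bar>)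
           (\<lambda>n. sqrt (ln (real (p n)) / real n))"
proof -
  obtain D where D: "D > 0" "\<forall>\<^sub>F n in sequentially. norm (ln (real (p n))) \<le> D * norm (real n)"
    using p_rate by (elim landau_o.bigE)
  \<comment> \<open>The largest \<open>b\<close> with \<open>b \<surd>(x / n) \<le> 1 / 4\<close> whenever \<open>x / n \<le> D + 1\<close>.\<close>
  define b where "b = 1 / (4 * sqrt (D + 1))"
  define K where "K = 2 / b * (8 + 4 * b\<^sup>2 + 1)"
  \<comment> \<open>The small-ball level for the probability \<open>exp (- (D + 2) n)\<close>, which beats \<open>p \<le> exp (D n)\<close> and the nets.\<close>
  define c where "c = 2 / (exp (4 * ((D + 2) + 1)) - 1)"
  have b: "b > 0" using D by (simp add: b_def)
  have K: "K > 0" using b by (simp add: K_def add_pos_nonneg)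
  have c: "c > 0" using D by (simp add: c_def)
  \<comment> \<open>\<open>U / 16\<close> bounds the form of \<open>S\<close> from above on unit vectors supported on a column support, and \<open>r\<close> is the fineness of the net that this requires.\<close>
  define U where "U = 16 * ((1 + 2 * (K / (4 * b))) / C0)"
  obtain r :: nat where r: "r \<ge> 2" "U \<le> c * C0 * (real r)\<^sup>2"
  proof -
    obtain m :: nat where m: "U / (c * C0) \<le> real m"
      using real_arch_simple by blast
    have "real m \<le> (real (m + 2))\<^sup>2"
      by (simp add: power2_eq_square algebra_simps)
    then have "U / (c * C0) \<le> (real (m + 2))\<^sup>2" using m by linarith
    then have "U \<le> c * C0 * (real (m + 2))\<^sup>2"
      using c C0 by (simp add: pos_divide_le_eq mult.commute)
    then show ?thesis using that[of "m + 2"] by simp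
  qed
  define \<kappa> where "\<kappa> = ln (3 * 2 ^ r :: real)"
  have \<kappa>: "\<kappa> > 0"
  proof -
    have "(1::real) \<le> 2 ^ r" by simp
    then have "(1::real) < 3 * 2 ^ r" by linarith
    then show ?thesis by (simp add: \<kappa>_def)
  qed
  define Kf where "Kf = K / C0 + 64 * K\<^sup>2 / (c * C0 ^ 5) * (1 + sqrt D)"
  have Kf: "Kf > 0" using K C0 c D by (simp add: Kf_def add_pos_nonneg)
  show ?thesis
    unfolding bigO_P_def
  proof (intro allI impI exI[of _ Kf] conjI Kf)
    fix \<epsilon> :: real assume \<epsilon>: "\<epsilon> > 0"
    have ev1: "\<forall>\<^sub>F n in sequentially. real (s0 n) \<le> sqrt n"
      using landau_o.smallD[OF s0_rate, of 1] by simp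
    have ev2: "\<forall>\<^sub>F n in sequentially. real (s0 n) * \<kappa> \<le> sqrt n"
      using landau_o.smallD[OF s0_rate, of "1 / \<kappa>"] \<kappa> by (simp add: field_simps)
    have ev3: "\<forall>\<^sub>F n in sequentially. real (p n) \<ge> max 3 (12 / \<epsilon>)"
      using filterlim_compose[OF filterlim_real_sequentially p_lim] unfolding filterlim_at_top by blast
    have ev4: "\<forall>\<^sub>F n in sequentially. real n \<ge> max 2 (2 / \<epsilon>)"
      using filterlim_real_sequentially unfolding filterlim_at_top by blast
    show "\<forall>\<^sub>F n in sequentially. 1 - \<epsilon> \<le> measure (M n) {\<omega> \<in> space (M n).
        \<bar>MAX (i, j) \<in> {..<p n} \<times> {..<p n}.
          \<bar>precision_estimator (p n) (col_support (\<Omega> n)) n (\<lambda>k. X n k \<omega>) $$ (i, j) - \<Omega> n $$ (i, j)\<bar>\<bar>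
        \<le> Kf * \<bar>sqrt (ln (real (p n)) / real n)\<bar>}"
      using D(2) ev1 ev2 ev3 ev4
    proof eventually_elim
      fix n
      assume Dn: "norm (ln (real (p n))) \<le> D * norm (real n)" and s1: "real (s0 n) \<le> sqrt n"
        and s2: "real (s0 n) * \<kappa> \<le> sqrt n" and pn: "real (p n) \<ge> max 3 (12 / \<epsilon>)"
        and n: "real n \<ge> max 2 (2 / \<epsilon>)"
      interpret sample: gaussian_sample "M n" n "p n" "\<mu> n" "\<Sigma> n" "X n"
        using prob mean spd indep normal by (intro gaussian_sample.intro gaussian_sample_axioms.intro)
      let ?L = "ln (real (p n))"
      define x where "x = real (s0 n) + ?L"
      define \<tau> where "\<tau> = sqrt (?L / n)"
      have n2: "n \<ge> 2" "real n \<ge> 2" using n by auto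
      have L1: "?L \<ge> 1"
      proof -
        have "exp 1 \<le> real (p n)" using exp_le pn by linarith
        then show ?thesis using pn by (simp add: ln_ge_iff)
      qed
      have LD: "?L \<le> D * real n" using Dn by simp
      have sqn: "sqrt n \<le> real n"
        using n2 by (intro real_le_lsqrt) (simp_all add: power2_eq_square)
      \<comment> \<open>The sparsity condition is used here: \<open>s0 / n \<le> 1 / \<surd>n\<close>, and \<open>ln p \<ge> 1\<close>.\<close>
      have s_tau: "real (s0 n) / n \<le> \<tau>"
      proof -
        have "real (s0 n) / n \<le> sqrt n / n" using s1 by (intro divide_right_mono) auto
        also have "\<dots> = sqrt (1 / n)"
          by (simp add: real_sqrt_divide sqrt_divide_self_eq inverse_eq_divide)
        also have "\<dots> \<le> \<tau>"
          unfolding \<tau>_def using L1 by (intro real_sqrt_le_mono divide_right_mono) auto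
        finally show ?thesis .
      qed
      \<comment> \<open>A second power of the rate is absorbed because \<open>ln p / n\<close> is bounded by \<open>D\<close>.\<close>
      have L_tau: "?L / n \<le> sqrt D * \<tau>"
      proof -
        have "\<tau> \<le> sqrt D"
          unfolding \<tau>_def using LD n2 by (intro real_sqrt_le_mono) (simp add: pos_divide_le_eq)
        then have "\<tau> * \<tau> \<le> sqrt D * \<tau>"
          using L1 by (intro mult_right_mono) (auto simp: \<tau>_def)
        moreover have "\<tau> * \<tau> = ?L / n" using L1 by (simp add: \<tau>_def)
        ultimately show ?thesis by simp
      qed
      have x_tau: "x / n \<le> (1 + sqrt D) * \<tau>"
        using s_tau L_tau by (simp add: x_def add_divide_distrib algebra_simps)
      have bx: "b * sqrt (x / n) \<le> 1 / 4"
      proof -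
        have "x \<le> (D + 1) * n" using s1 sqn LD by (simp add: x_def algebra_simps)
        then have "sqrt (x / n) \<le> sqrt (D + 1)"
          using n2 by (intro real_sqrt_le_mono) (simp add: pos_divide_le_eq)
        then have "b * sqrt (x / n) \<le> b * sqrt (D + 1)" using b by (intro mult_left_mono) auto
        also have "\<dots> = 1 / 4" using D by (simp add: b_def)
        finally show ?thesis .
      qed
      have bound: "K * sqrt (?L / n) / C0 + 64 * (K * sqrt (x / n))\<^sup>2 / (c * C0 ^ 5) \<le> Kf * \<bar>\<tau>\<bar>"
      proof -
        have "(sqrt (x / n))\<^sup>2 = x / n" using L1 by (simp add: x_def)
        then have "64 * (K * sqrt (x / n))\<^sup>2 / (c * C0 ^ 5) = 64 * K\<^sup>2 / (c * C0 ^ 5) * (x / n)"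
          by (simp add: power_mult_distrib ac_simps)
        also have "\<dots> \<le> 64 * K\<^sup>2 / (c * C0 ^ 5) * ((1 + sqrt D) * \<tau>)"
          using x_tau c C0 by (intro mult_left_mono) auto
        finally have "K * sqrt (?L / n) / C0 + 64 * (K * sqrt (x / n))\<^sup>2 / (c * C0 ^ 5) \<le>
            K / C0 * \<tau> + 64 * K\<^sup>2 / (c * C0 ^ 5) * (1 + sqrt D) * \<tau>"
          by (simp add: \<tau>_def mult.assoc)
        also have "\<dots> = Kf * \<tau>" by (simp add: Kf_def algebra_simps)
        finally show ?thesis using L1 by (simp add: \<tau>_def)
      qed
      define w where "w i = (\<lambda>j. if j < p n then \<Omega> n $$ (j, i) else 0)" for i
      have Sig: "\<Sigma> n \<in> carrier_mat (p n) (p n)" "sym_entries (p n) (\<Sigma> n)"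
        using spd[of n] sym_pos_def_sym_entries by (auto simp: sym_pos_def_def)
      have Om: "\<Omega> n \<in> carrier_mat (p n) (p n)"
        unfolding prec by (rule inv_mat_correct(1)[OF Sig(1) sym_pos_def_det[OF spd]])
      have p0: "p n > 0" using p_pos[of n] by simp
      note ev = quadratic_form_eigenvalue_bounds[OF Sig p0 spectrum[of n]]
      have "1 - (6 / p n + exp (- real n)) \<le> measure (M n) {\<omega> \<in> space (M n). \<forall>i<p n. \<forall>j<p n.
          \<bar>col_estimator (p n) (col_support (\<Omega> n) i) (sample.S \<omega>) i $ j - w i j\<bar> \<le> Kf * \<bar>\<tau>\<bar>}"
      proof (rule sample.precision_estimation_error[where s = "s0 n" and r = r and D = D and x = x and b = b
            and K = K and c = c and ?C0.0 = C0])
        show "col_support (\<Omega> n) i \<subseteq> {..<p n}" for i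
          using Om by (auto simp: col_support_def)
        show "solves_on (p n) (col_support (\<Omega> n) i) (\<Sigma> n) i (w i)" if "i < p n" for i
          unfolding w_def prec by (rule solves_on_inverse_column[OF spd that])
        show "C0 * sqnorm (p n) v \<le> bform (p n) (\<Sigma> n) v v" for v by (rule ev(1))
        show "bform (p n) (\<Sigma> n) v v \<le> 1 / C0 * sqnorm (p n) v" for v
          using ev(2)[of v] by (simp add: inverse_eq_divide)
        show "real (s0 n) * ln (3 * 2 ^ r) \<le> real n"
          using s2 sqn by (simp add: \<kappa>_def)
        show "16 * ((1 + 2 * (K / (4 * b))) / C0) \<le> c * C0 * (real r)\<^sup>2"
          using r(2) by (simp add: U_def)
      qed (use sparse s0_pos C0 n2 L1 p_pos D(1) LD x_def b bx K_def c_def r bound in auto)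
      also have "{\<omega> \<in> space (M n). \<forall>i<p n. \<forall>j<p n.
          \<bar>col_estimator (p n) (col_support (\<Omega> n) i) (sample.S \<omega>) i $ j - w i j\<bar> \<le> Kf * \<bar>\<tau>\<bar>} =
        {\<omega> \<in> space (M n). \<bar>MAX (i, j) \<in> {..<p n} \<times> {..<p n}.
          \<bar>precision_estimator (p n) (col_support (\<Omega> n)) n (\<lambda>k. X n k \<omega>) $$ (i, j) - \<Omega> n $$ (i, j)\<bar>\<bar>
        \<le> Kf * \<bar>\<tau>\<bar>}"
      proof -
        have "col_estimator (p n) (col_support (\<Omega> n) i) (sample.S \<omega>) i $ j - w i j =
            precision_estimator (p n) (col_support (\<Omega> n)) n (\<lambda>k. X n k \<omega>) $$ (j, i) - \<Omega> n $$ (j, i)"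
          if "i < p n" "j < p n" for i j \<omega>
          using that by (simp add: precision_estimator_def sample.S_def w_def mat_of_cols_index)
        then show ?thesis
          unfolding abs_Max_le_iff[OF p_pos] by auto
      qed
      finally have "1 - (6 / p n + exp (- real n)) \<le> measure (M n) {\<omega> \<in> space (M n).
        \<bar>MAX (i, j) \<in> {..<p n} \<times> {..<p n}.
          \<bar>precision_estimator (p n) (col_support (\<Omega> n)) n (\<lambda>k. X n k \<omega>) $$ (i, j) - \<Omega> n $$ (i, j)\<bar>\<bar>
        \<le> Kf * \<bar>sqrt (ln (real (p n)) / real n)\<bar>}"
        by (simp only: \<tau>_def)
      moreover have "6 / p n \<le> \<epsilon> / 2"
        using pn \<epsilon> by (simp add: field_simps)
      moreover have "exp (- real n) \<le> \<epsilon> / 2"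
      proof -
        have exp_ge_self: "real n \<le> exp (real n)"
          using exp_ge_add_one_self[of "real n"] by linarith
        have "exp (- real n) = 1 / exp (real n)" by (simp add: exp_minus inverse_eq_divide)
        also have "\<dots> \<le> 1 / real n"
          using exp_ge_self n2 by (intro divide_left_mono) auto
        also have "\<dots> \<le> \<epsilon> / 2" using n \<epsilon> by (simp add: field_simps)
        finally show ?thesis .
      qed
      ultimately show "1 - \<epsilon> \<le> measure (M n) {\<omega> \<in> space (M n).
        \<bar>MAX (i, j) \<in> {..<p n} \<times> {..<p n}.
          \<bar>precision_estimator (p n) (col_support (\<Omega> n)) n (\<lambda>k. X n k \<omega>) $$ (i, j) - \<Omega> n $$ (i, j)\<bar>\<bar>
        \<le> Kf * \<bar>sqrt (ln (real (p n)) / real n)\<bar>}"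
        by linarith
    qed
  qed
qed

end
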